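(* Let $U\in\mathcal C^1(\mathbb R^d)$ with $\int_{\mathbb R^d}e^{-U(x)}\,dx<\infty$, let $\gamma$ be the standard Gaussian distribution $\mathcal N(0,\mathrm{Id})$ on $\mathbb R^d$, and let $\pi(dx\,dv)\propto e^{-U(x)}\,dx\,\gamma(dv)$. Let $\varepsilon:\mathbb R^d\to(0,+\infty)$ be a strictly positive measurable function. Set $T(x)=\nabla U(x)/|\nabla U(x)|$ if $\nabla U(x)\neq0$ and $T(x)=0$ otherwise. Let $G$ be a standard one-dimensional Gaussian random variable and, writing $\varepsilon=\varepsilon(x)$ and $T=T(x)$, let $$V'=v-\frac{2\varepsilon}{1+\varepsilon^2}\left(\varepsilon\, v\cdot T+G\right)T .$$ Let $q_0$ be the kernel defined by $$\int\varphi(v')\,q_0(x,v;dv')=\frac{1+\varepsilon^2}{\varepsilon^2}\,\mathbb E\left[\varphi(V')\right],$$ and consider the generator $\mathcal L=\mathcal T+\mathcal F$, where $\mathcal T=v\cdot\nabla_x$ and $$\mathcal F\varphi(x,v)=\frac12\int\left(\varphi(x,v')-\varphi(x,v)\right)\left(\nabla U(x)\cdot(v-v')\right)_+\,q_0(x,v;dv').$$ Then: (1) the kernel $q_0$ satisfies the average condition and is reversible with respect to $\gamma$; (2) consequently the process with generator $\mathcal L$ leaves the target distribution $\pi$ invariant, in the sense that $\int\mathcal L\varphi\,d\pi=0$ for all $\varphi\in\mathcal C_c^\infty(\mathbb R^{2d})$, so that $\pi$ is an invariant measure of the process whenever $\mathcal C^\infty_c(\mathbb R^{2d})$ is a core for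 $\mathcal L$.
   Context: A non-negative kernel $q_0(x,v;dv')$ (for $x,v\in\mathbb R^d$) is reversible with respect to $\gamma$ if for all $x\in\mathbb R^d$, $q_0(x,v;dv')\gamma(dv)=q_0(x,v';dv)\gamma(dv')$ as measures on $\mathbb R^d\times\mathbb R^d$. It satisfies the average condition if $\int(1+|v'|)\,q_0(x,v;dv')<\infty$ for all $(x,v)\in\mathbb R^{2d}$ and $$\nabla U(x)\cdot\int_{\mathbb R^d}\tfrac12(v-v')\,q_0(x,v;dv')=\nabla U(x)\cdot v\qquad\text{for }dx\,\gamma(dv)\text{-a.e. }(x,v).$$ Here $(s)_+=\max(s,0)$. The process with generator $\mathcal L=\mathcal T+\mathcal F$ is the velocity jump process: $x$ moves at velocity $v$, and $v$ is piecewise constant and jumps according to the non-normalized kernel $q(x,v;dv')=\frac12(\nabla U(x)\cdot(v-v'))_+q_0(x,v;dv')$. *)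

theory Defs
  imports "HOL-Probability.Probability"
begin

section \<open>Calculus\<close>

definition grad :: "('a::real_inner \<Rightarrow> real) \<Rightarrow> 'a \<Rightarrow> 'a" where
  "grad f x = (THE D. GDERIV f x :> D)"

text \<open>A function is of class $C^{k+1}$ iff it is differentiable everywhere and all its partial
  derivatives are of class $C^k$.\<close>

primrec C_k :: "nat \<Rightarrow> ('a::euclidean_space \<Rightarrow> real) \<Rightarrow> bool" where
  "C_k 0 f \<longleftrightarrow> continuous_on UNIV f"
| "C_k (Suc k) f \<longleftrightarrow>
     (\<forall>x. f differentiable (at x)) \<and> (\<forall>b\<in>Basis. C_k k (\<lambda>x. frechet_derivative f (at x) b))"

definition Cc_infty :: "('a::euclidean_space \<Rightarrow> real) set" where
  "Cc_infty = {f. (\<forall>k. C_k k f) \<and> compact (closure {x. f x \<noteq> 0})}"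

section \<open>Gaussian and target distributions\<close>

definition std_gauss1 :: "real measure" where
  "std_gauss1 = density lborel (\<lambda>g. ennreal (std_normal_density g))"

definition std_gauss :: "(real ^ 'n) measure" where
  "std_gauss = density lborel (\<lambda>v. ennreal (\<Prod>i\<in>UNIV. std_normal_density (v $ i)))"

definition target :: "(real ^ 'n \<Rightarrow> real) \<Rightarrow> ((real ^ 'n) \<times> (real ^ 'n)) measure" where
  "target U = density (lborel \<Otimes>\<^sub>M std_gauss)
     (\<lambda>(x, v). ennreal (exp (- U x) / (LINT y|lborel. exp (- U y))))"

section \<open>Non-negative kernels \<open>q\<^sub>0(x,v;dv')\<close>\<close>

definition transition_kernel :: "(real ^ 'n \<Rightarrow> real ^ 'n \<Rightarrow> (real ^ 'n) measure) \<Rightarrow> bool" where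
  "transition_kernel q \<longleftrightarrow> (\<forall>x v. sets (q x v) = sets borel) \<and>
     (\<forall>A\<in>sets borel. (\<lambda>(x, v). emeasure (q x v) A) \<in> borel_measurable borel)"

text \<open>Equality of the measures $q(x,v;dv')\gamma(dv)$ and $q(x,v';dv)\gamma(dv')$ in the variable
  $(v,v')$, expressed on every Borel set $A$ of pairs. (The Giry bind is not available here since the
  kernels need not be sub-probabilities.)\<close>

definition reversible ::
  "(real ^ 'n \<Rightarrow> real ^ 'n \<Rightarrow> (real ^ 'n) measure) \<Rightarrow> (real ^ 'n) measure \<Rightarrow> bool" where
  "reversible q \<gamma> \<longleftrightarrow> (\<forall>x. \<forall>A\<in>sets (borel :: ((real ^ 'n) \<times> (real ^ 'n)) measure).
     (\<integral>\<^sup>+v. emeasure (q x v) {v'. (v, v') \<in> A} \<partial>\<gamma>) =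
     (\<integral>\<^sup>+v'. emeasure (q x v') {v. (v, v') \<in> A} \<partial>\<gamma>))"

definition average_condition ::
  "(real ^ 'n \<Rightarrow> real) \<Rightarrow> (real ^ 'n \<Rightarrow> real ^ 'n \<Rightarrow> (real ^ 'n) measure) \<Rightarrow> bool" where
  "average_condition U q \<longleftrightarrow>
     (\<forall>x v. (\<integral>\<^sup>+v'. ennreal (1 + norm v') \<partial>q x v) < \<infinity>) \<and>
     (AE (x, v) in lborel \<Otimes>\<^sub>M std_gauss.
        grad U x \<bullet> (LINT v'|q x v. (1/2) *\<^sub>R (v - v')) = grad U x \<bullet> v)"

section \<open>The velocity jump generator\<close>

definition transport :: "((real ^ 'n) \<times> (real ^ 'n) \<Rightarrow> real) \<Rightarrow> (real ^ 'n) \<times> (real ^ 'n) \<Rightarrow> real" where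
  "transport \<phi> = (\<lambda>(x, v). v \<bullet> grad (\<lambda>y. \<phi> (y, v)) x)"

definition jump ::
  "(real ^ 'n \<Rightarrow> real) \<Rightarrow> (real ^ 'n \<Rightarrow> real ^ 'n \<Rightarrow> (real ^ 'n) measure) \<Rightarrow>
   ((real ^ 'n) \<times> (real ^ 'n) \<Rightarrow> real) \<Rightarrow> (real ^ 'n) \<times> (real ^ 'n) \<Rightarrow> real" where
  "jump U q \<phi> = (\<lambda>(x, v).
     1/2 * (LINT v'|q x v. (\<phi> (x, v') - \<phi> (x, v)) * max (grad U x \<bullet> (v - v')) 0))"

definition gen_L ::
  "(real ^ 'n \<Rightarrow> real) \<Rightarrow> (real ^ 'n \<Rightarrow> real ^ 'n \<Rightarrow> (real ^ 'n) measure) \<Rightarrow>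
   ((real ^ 'n) \<times> (real ^ 'n) \<Rightarrow> real) \<Rightarrow> (real ^ 'n) \<times> (real ^ 'n) \<Rightarrow> real" where
  "gen_L U q \<phi> z = transport \<phi> z + jump U q \<phi> z"

section \<open>The autoregressive kernel along the gradient\<close>

definition unit_grad :: "(real ^ 'n \<Rightarrow> real) \<Rightarrow> real ^ 'n \<Rightarrow> real ^ 'n" where
  "unit_grad U x = (if grad U x \<noteq> 0 then (1 / norm (grad U x)) *\<^sub>R grad U x else 0)"

definition refreshed ::
  "(real ^ 'n \<Rightarrow> real) \<Rightarrow> (real ^ 'n \<Rightarrow> real) \<Rightarrow> real ^ 'n \<Rightarrow> real ^ 'n \<Rightarrow> real \<Rightarrow> real ^ 'n" where
  "refreshed U \<epsilon> x v g =
     v - (2 * \<epsilon> x / (1 + (\<epsilon> x)\<^sup>2) * (\<epsilon> x * (v \<bullet> unit_grad U x) + g)) *\<^sub>R unit_grad U x"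

definition q0 ::
  "(real ^ 'n \<Rightarrow> real) \<Rightarrow> (real ^ 'n \<Rightarrow> real) \<Rightarrow> real ^ 'n \<Rightarrow> real ^ 'n \<Rightarrow> (real ^ 'n) measure" where
  "q0 U \<epsilon> x v = scale_measure (ennreal ((1 + (\<epsilon> x)\<^sup>2) / (\<epsilon> x)\<^sup>2))
     (distr std_gauss1 borel (refreshed U \<epsilon> x v))"

section \<open>Markov semigroups, generators, cores\<close>

definition markov_transition :: "(real \<Rightarrow> 'z::topological_space \<Rightarrow> 'z measure) \<Rightarrow> bool" where
  "markov_transition P \<longleftrightarrow>
     (\<forall>t\<ge>0. P t \<in> borel \<rightarrow>\<^sub>M prob_algebra borel) \<and>
     (\<forall>z. P 0 z = return borel z) \<and>
     (\<forall>s\<ge>0. \<forall>t\<ge>0. \<forall>z. P (s + t) z = P s z \<bind> P t)"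

definition invariant_measure ::
  "(real \<Rightarrow> 'z::topological_space \<Rightarrow> 'z measure) \<Rightarrow> 'z measure \<Rightarrow> bool" where
  "invariant_measure P \<mu> \<longleftrightarrow> (\<forall>t\<ge>0. \<mu> \<bind> P t = \<mu>)"

definition transition_op ::
  "(real \<Rightarrow> 'z \<Rightarrow> 'z measure) \<Rightarrow> real \<Rightarrow> ('z \<Rightarrow> real) \<Rightarrow> 'z \<Rightarrow> real" where
  "transition_op P t f z = (LINT w|P t z. f w)"

text \<open>The spaces on which semigroups act are spaces \<open>E\<close> of Borel functions with a seminorm \<open>N\<close> that
  embed continuously into $L^1(\mu)$; functions at \<open>N\<close>-distance \<open>0\<close> are identified. Examples are
  $C_0$ or the bounded Borel functions with the supremum norm, and $L^p(\mu)$ for $1 \le p < \infty$.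
  Completeness is not required, so Banach function spaces are a special case.\<close>

definition function_space ::
  "'z::topological_space measure \<Rightarrow> ('z \<Rightarrow> real) set \<Rightarrow> (('z \<Rightarrow> real) \<Rightarrow> real) \<Rightarrow> bool" where
  "function_space \<mu> E N \<longleftrightarrow>
     E \<subseteq> borel_measurable borel \<and> (\<lambda>_. 0) \<in> E \<and>
     (\<forall>f\<in>E. \<forall>g\<in>E. (\<lambda>z. f z + g z) \<in> E \<and> N (\<lambda>z. f z + g z) \<le> N f + N g) \<and>
     (\<forall>f\<in>E. \<forall>c. (\<lambda>z. c * f z) \<in> E \<and> N (\<lambda>z. c * f z) = \<bar>c\<bar> * N f) \<and>
     (\<exists>C. \<forall>f\<in>E. integrable \<mu> f \<and> (LINT z|\<mu>. \<bar>f z\<bar>) \<le> C * N f)"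

text \<open>Strongly continuous semigroup of bounded linear operators on the seminormed space \<open>(E, N)\<close>
  (equalities hold modulo functions of seminorm \<open>0\<close>; the orbits are continuous on $[0,\infty)$).
  No contraction property is assumed.\<close>

definition C0_semigroup ::
  "('z \<Rightarrow> real) set \<Rightarrow> (('z \<Rightarrow> real) \<Rightarrow> real) \<Rightarrow> (real \<Rightarrow> ('z \<Rightarrow> real) \<Rightarrow> 'z \<Rightarrow> real) \<Rightarrow> bool" where
  "C0_semigroup E N S \<longleftrightarrow>
     (\<forall>t\<ge>0. (\<forall>f\<in>E. S t f \<in> E) \<and> (\<exists>C. \<forall>f\<in>E. N (S t f) \<le> C * N f)) \<and>
     (\<forall>t\<ge>0. \<forall>f\<in>E. \<forall>g\<in>E. \<forall>a b.
        N (\<lambda>z. S t (\<lambda>w. a * f w + b * g w) z - (a * S t f z + b * S t g z)) = 0) \<and>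
     (\<forall>f\<in>E. N (\<lambda>z. S 0 f z - f z) = 0) \<and>
     (\<forall>s\<ge>0. \<forall>t\<ge>0. \<forall>f\<in>E. N (\<lambda>z. S (s + t) f z - S s (S t f) z) = 0) \<and>
     (\<forall>f\<in>E. \<forall>t\<ge>0. ((\<lambda>s. N (\<lambda>z. S s f z - S t f z)) \<longlongrightarrow> 0) (at t within {0..}))"

text \<open>The infinitesimal generator, as a graph.\<close>

definition generator ::
  "('z \<Rightarrow> real) set \<Rightarrow> (('z \<Rightarrow> real) \<Rightarrow> real) \<Rightarrow> (real \<Rightarrow> ('z \<Rightarrow> real) \<Rightarrow> 'z \<Rightarrow> real) \<Rightarrow>
   (('z \<Rightarrow> real) \<times> ('z \<Rightarrow> real)) set" where
  "generator E N S = {(f, g). f \<in> E \<and> g \<in> E \<and>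
     ((\<lambda>h. N (\<lambda>z. (S h f z - f z) / h - g z)) \<longlongrightarrow> 0) (at_right 0)}"

text \<open>\<open>D\<close> is a core of the operator with graph \<open>A\<close>: it is a subset of the domain, and \<open>A\<close> restricted
  to \<open>D\<close> is dense in \<open>A\<close> for the graph norm.\<close>

definition is_core ::
  "(('z \<Rightarrow> real) \<Rightarrow> real) \<Rightarrow> (('z \<Rightarrow> real) \<times> ('z \<Rightarrow> real)) set \<Rightarrow> ('z \<Rightarrow> real) set \<Rightarrow> bool" where
  "is_core N A D \<longleftrightarrow> D \<subseteq> Domain A \<and>
     (\<forall>(f, g)\<in>A. \<forall>\<delta>>0. \<exists>(\<phi>, \<psi>)\<in>A. \<phi> \<in> D \<and> N (\<lambda>z. f z - \<phi> z) < \<delta> \<and> N (\<lambda>z. g z - \<psi> z) < \<delta>)"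

text \<open>\<open>P\<close> is the transition function of a Markov process whose semigroup on \<open>(E, N)\<close> has a generator
  given by \<open>L\<close> on the test functions \<open>D\<close>.\<close>

definition markov_with_generator ::
  "'z::topological_space measure \<Rightarrow> ('z \<Rightarrow> real) set \<Rightarrow> (('z \<Rightarrow> real) \<Rightarrow> real) \<Rightarrow>
   (real \<Rightarrow> 'z \<Rightarrow> 'z measure) \<Rightarrow> (('z \<Rightarrow> real) \<Rightarrow> 'z \<Rightarrow> real) \<Rightarrow> ('z \<Rightarrow> real) set \<Rightarrow> bool" where
  "markov_with_generator \<mu> E N P L D \<longleftrightarrow>
     markov_transition P \<and> function_space \<mu> E N \<and>
     (\<forall>t\<ge>0. \<forall>f\<in>E. AE z in \<mu>. integrable (P t z) f) \<and>
     C0_semigroup E N (transition_op P) \<and>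
     (\<forall>\<phi>\<in>D. (\<phi>, L \<phi>) \<in> generator E N (transition_op P))"

end

theory Submission
  imports Defs
begin

text \<open>
  Fix \<open>x\<close> and write \<open>T\<close> for the unit gradient, \<open>e = \<epsilon> x\<close> and \<open>s = v \<bullet> T\<close>. A jump leaves the component of
  the velocity orthogonal to \<open>T\<close> unchanged and replaces \<open>s\<close> by \<open>s' = \<rho> s - \<sigma> G\<close>, where
  \<open>\<rho> = (1 - e\<^sup>2) / (1 + e\<^sup>2)\<close> and \<open>\<sigma> = 2 e / (1 + e\<^sup>2)\<close> satisfy \<open>\<rho>\<^sup>2 + \<sigma>\<^sup>2 = 1\<close>. This is a Gaussian
  autoregression. Together with \<open>G' = - \<sigma> s - \<rho> G\<close> it becomes a reflection of the space of pairs
  \<open>(v, G)\<close>: a linear isometry that is its own inverse and hence preserves the Gaussian law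
  \<open>\<gamma> \<otimes> N(0, 1)\<close>. Therefore \<open>(v, V')\<close> and \<open>(V', v)\<close> have the same distribution under \<open>\<gamma>\<close>
  (\<open>autoreg_pair_swap\<close>), which is the reversibility of \<open>q\<^sub>0\<close>. (Where the
  gradient vanishes, \<open>T = 0\<close>, the velocity does not change and the map only changes the sign of \<open>G\<close>.)
  The average condition is the formula
  \<open>E (v - V') = \<sigma> e s T\<close>, multiplied by half the mass \<open>(1 + e\<^sup>2) / e\<^sup>2\<close> of \<open>q\<^sub>0\<close>.

  To see that the generator has mean zero, exchange \<open>v\<close> and \<open>V'\<close> in the jump integral and take the mean
  of both expressions. Since \<open>max r 0 - max (- r) 0 = r\<close>, the positive parts disappear, and the average
  condition turns the rest into \<open>- \<integral>\<phi>(x, v) (\<nabla>U(x) \<bullet> v) \<gamma>(dv)\<close> (\<open>gauss_jump_integral\<close>). Integration by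
  parts in \<open>x\<close> against \<open>exp (- U)\<close> gives the same quantity with the opposite sign for the transport part
  (\<open>transport_integral_by_parts\<close>). All integrals converge although \<open>e\<close> may be arbitrarily close to \<open>0\<close>:
  the rate and the increment of \<open>\<phi>\<close> are both at most proportional to \<open>\<bar>v - V'\<bar>\<close>, and
  \<open>(1 + e\<^sup>2) / e\<^sup>2 * E \<bar>v - V'\<bar>\<^sup>2 \<le> 4 (1 + \<bar>v\<bar>\<^sup>2)\<close> uniformly in \<open>e\<close> (\<open>jump_q0_bound\<close>).

  For the invariance, the core property extends \<open>\<integral>L \<phi> d\<pi> = 0\<close> from test functions to the whole graph of
  the semigroup's generator. Then \<open>t \<mapsto> \<integral>P\<^sub>t \<phi> d\<pi>\<close> is continuous with right derivative \<open>0\<close>, so it is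
  constant (\<open>semigroup_preserves_integral\<close>). Test functions determine finite measures
  (\<open>finite_measure_eqI_Cc_infty\<close>), so \<open>\<pi>\<close> is invariant.
\<close>

section \<open>Functions of class $C^k$ and their gradients\<close>

lemma C_k_Suc_imp_C_k: "C_k (Suc k) f \<Longrightarrow> C_k k f"
proof (induction k arbitrary: f)
  case 0
  then show ?case
    by (auto intro!: continuous_at_imp_continuous_on differentiable_imp_continuous_within)
qed simp

text \<open>The derivative need not be presented as \<open>frechet_derivative\<close>: any family of derivatives with
  components of class $C^k$ will do, which is what the closure properties below produce.\<close>

lemma C_k_SucI:
  assumes "\<And>x. (f has_derivative f' x) (at x)" and "\<And>b. b \<in> Basis \<Longrightarrow> C_k k (\<lambda>x. f' x b)"
  shows "C_k (Suc k) f"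
proof -
  have "frechet_derivative f (at x) = f' x" for x
    using frechet_derivative_at[OF assms(1)] by simp
  then show ?thesis
    using assms by (auto simp: differentiable_def)
qed

lemma C_k_Suc_has_derivative:
  "C_k (Suc k) f \<Longrightarrow> (f has_derivative frechet_derivative f (at x)) (at x)"
  by (simp add: frechet_derivative_works)

lemma C_k_const: "C_k k (\<lambda>x. c)"
  by (induction k arbitrary: c) auto

lemma C_k_inner: "C_k k (\<lambda>x. x \<bullet> a)"
proof (cases k)
  case (Suc l)
  have "C_k (Suc l) (\<lambda>x. x \<bullet> a)"
    by (rule C_k_SucI[where f' = "\<lambda>x h. h \<bullet> a"]) (auto intro!: derivative_eq_intros C_k_const)
  then show ?thesis using Suc by simp
qed (auto intro!: continuous_intros)

lemma C_k_add: "C_k k f \<Longrightarrow> C_k k g \<Longrightarrow> C_k k (\<lambda>x. f x + g x)"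
proof (induction k arbitrary: f g)
  case (Suc k)
  note f = C_k_Suc_has_derivative[OF Suc.prems(1)] and g = C_k_Suc_has_derivative[OF Suc.prems(2)]
  show ?case
    using Suc.prems by (intro C_k_SucI[OF has_derivative_add[OF f g]] Suc.IH) auto
qed (auto intro!: continuous_intros)

lemma C_k_mult: "C_k k f \<Longrightarrow> C_k k g \<Longrightarrow> C_k k (\<lambda>x. f x * g x)"
proof (induction k arbitrary: f g)
  case (Suc k)
  note f = C_k_Suc_has_derivative[OF Suc.prems(1)] and g = C_k_Suc_has_derivative[OF Suc.prems(2)]
  show ?case
    using Suc.prems C_k_Suc_imp_C_k
    by (intro C_k_SucI[OF has_derivative_mult[OF f g]] C_k_add Suc.IH) auto
qed (auto intro!: continuous_intros)

lemma C_k_diff: "C_k k f \<Longrightarrow> C_k k g \<Longrightarrow> C_k k (\<lambda>x. f x - g x)"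
  using C_k_add[of k f "\<lambda>x. (-1) * g x"] C_k_mult[OF C_k_const[of k "-1"], of g] by simp

lemma C_k_prod: "finite I \<Longrightarrow> (\<And>i. i \<in> I \<Longrightarrow> C_k k (f i)) \<Longrightarrow> C_k k (\<lambda>x. \<Prod>i\<in>I. f i x)"
  by (induction I rule: finite_induct) (auto intro!: C_k_const C_k_mult)

lemma grad_eqI:
  assumes "(f has_derivative (\<lambda>h. h \<bullet> D)) (at x)"
  shows "grad f x = D"
  unfolding grad_def
proof (rule the_equality)
  show "GDERIV f x :> D" using assms by (simp add: gderiv_def)
  fix D' assume "GDERIV f x :> D'"
  then have "(\<lambda>h. h \<bullet> D') = (\<lambda>h. h \<bullet> D)"
    unfolding gderiv_def using assms by (rule has_derivative_unique)
  then have "(D' - D) \<bullet> D' = (D' - D) \<bullet> D" by metis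
  then have "(D' - D) \<bullet> (D' - D) = 0" by (simp add: inner_diff_right)
  then show "D' = D" by simp
qed

lemma has_derivative_grad:
  fixes f :: "'a::euclidean_space \<Rightarrow> real"
  assumes "f differentiable at x"
  shows "(f has_derivative (\<lambda>h. h \<bullet> grad f x)) (at x)"
proof -
  let ?f' = "frechet_derivative f (at x)"
  have f': "(f has_derivative ?f') (at x)"
    using assms frechet_derivative_works by blast
  have "?f' = (\<lambda>h. h \<bullet> adjoint ?f' 1)"
    using adjoint_works[OF linear_frechet_derivative[OF assms], of _ 1] by simp
  then have "(f has_derivative (\<lambda>h. h \<bullet> adjoint ?f' 1)) (at x)"
    using f' by simp
  then show ?thesis using grad_eqI by metis
qed

lemma C_k_Suc_has_derivative_grad:
  "C_k (Suc k) f \<Longrightarrow> (f has_derivative (\<lambda>h. h \<bullet> grad f x)) (at x)"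
  by (intro has_derivative_grad) simp

lemma C_1_continuous_grad:
  fixes f :: "'a::euclidean_space \<Rightarrow> real"
  assumes "C_k 1 f"
  shows "continuous_on UNIV (grad f)"
proof -
  have f: "C_k (Suc 0) f" using assms by simp
  have "frechet_derivative f (at x) = (\<lambda>h. h \<bullet> grad f x)" for x
    using frechet_derivative_at[OF C_k_Suc_has_derivative_grad[OF f]] by simp
  then have "continuous_on UNIV (\<lambda>x. b \<bullet> grad f x)" if "b \<in> Basis" for b
    using f that by simp
  then have "continuous_on UNIV (\<lambda>x. \<Sum>b\<in>Basis. (b \<bullet> grad f x) *\<^sub>R b)"
    by (intro continuous_on_sum continuous_on_scaleR continuous_on_const)
  then show ?thesis
    by (simp add: inner_commute[of _ "grad f _"] euclidean_representation)
qed

section \<open>Compact support and integration by parts\<close>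

lemma continuous_compact_support_integrable:
  fixes f :: "'a::euclidean_space \<Rightarrow> real"
  assumes "continuous_on UNIV f" and supp: "\<And>x. R < norm x \<Longrightarrow> f x = 0"
  shows "integrable lborel f"
proof -
  have "integrable lborel (\<lambda>x. indicator (cball 0 R) x *\<^sub>R f x)"
    using continuous_on_subset[OF assms(1)] by (intro borel_integrable_compact) auto
  also have "(\<lambda>x. indicator (cball 0 R) x *\<^sub>R f x) = f"
    using supp by (force simp: indicator_def not_le)
  finally show ?thesis .
qed

lemma continuous_compact_support_bounded:
  fixes f :: "'a::euclidean_space \<Rightarrow> 'b::real_normed_vector"
  assumes "continuous_on UNIV f" and supp: "\<And>x. R < norm x \<Longrightarrow> f x = 0"
  obtains B where "0 \<le> B" "\<And>x. norm (f x) \<le> B"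
proof -
  have "bounded (f ` cball 0 R)"
    by (intro compact_imp_bounded compact_continuous_image continuous_on_subset[OF assms(1)]) auto
  then obtain B where "\<forall>y\<in>f ` cball 0 R. norm y \<le> B"
    unfolding bounded_iff by blast
  then have "norm x \<le> R \<Longrightarrow> norm (f x) \<le> B" for x
    by simp
  then have "norm (f x) \<le> max B 0" for x
    using supp[of x] by (cases "norm x \<le> R") (fastforce simp: not_le)+
  then show ?thesis using that[of "max B 0"] by simp
qed

text \<open>The complement of a closed ball is open, so a function that vanishes there also has derivative zero.\<close>

lemma has_derivative_outside_support:
  fixes f :: "'a::real_normed_vector \<Rightarrow> 'b::real_normed_vector"
  assumes "(f has_derivative f') (at x)" and "\<And>x. R < norm x \<Longrightarrow> f x = 0" and "R < norm x"
  shows "f' = (\<lambda>h. 0)"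
proof -
  have "open (norm -` {R<..} :: 'a set)"
    by (intro open_vimage continuous_on_norm_id) auto
  then have "((\<lambda>x. 0) has_derivative f') (at x)"
    using assms by (intro has_derivative_transform_within_open[OF assms(1), where s = "norm -` {R<..}"]) auto
  then show ?thesis
    using has_derivative_const has_derivative_unique by blast
qed

lemma lborel_integral_shift:
  fixes f :: "'a::euclidean_space \<Rightarrow> real"
  assumes [measurable]: "f \<in> borel_measurable borel"
  shows "integrable lborel (\<lambda>x. f (x + c)) \<longleftrightarrow> integrable lborel f"
    and "(LINT x|lborel. f (x + c)) = (LINT x|lborel. f x)"
proof -
  have "integrable (distr lborel borel ((+) c)) f \<longleftrightarrow> integrable lborel (\<lambda>x. f (c + x))"
    by (rule integrable_distr_eq) auto
  then show "integrable lborel (\<lambda>x. f (x + c)) \<longleftrightarrow> integrable lborel f"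
    by (simp add: lborel_distr_plus add.commute)
  have "(LINT x|distr lborel borel ((+) c). f x) = (LINT x|lborel. f (c + x))"
    by (rule integral_distr) auto
  then show "(LINT x|lborel. f (x + c)) = (LINT x|lborel. f x)"
    by (simp add: lborel_distr_plus add.commute)
qed

text \<open>The integral of a difference quotient of \<open>f\<close> vanishes by translation invariance of Lebesgue
  measure; the quotients are dominated by a constant on a bounded set, so their limit has integral zero
  as well.\<close>

lemma integral_directional_derivative_eq_0:
  fixes f :: "'a::euclidean_space \<Rightarrow> real"
  assumes der: "\<And>x. (f has_derivative f' x) (at x)"
    and cont: "continuous_on UNIV (\<lambda>x. f' x v)"
    and supp: "\<And>x. R < norm x \<Longrightarrow> f x = 0"
  shows "(LINT x|lborel. f' x v) = 0"
proof -
  have contf: "continuous_on UNIV f"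
    using der has_derivative_continuous by (blast intro: continuous_at_imp_continuous_on)
  then have [measurable]: "f \<in> borel_measurable borel"
    by (rule borel_measurable_continuous_onI)
  have [measurable]: "(\<lambda>x. f' x v) \<in> borel_measurable borel"
    using cont by (rule borel_measurable_continuous_onI)
  have int: "integrable lborel f"
    using contf supp by (rule continuous_compact_support_integrable)
  obtain B where B: "0 \<le> B" "\<And>x. norm (f' x v) \<le> B"
  proof (rule continuous_compact_support_bounded[OF cont])
    show "f' x v = 0" if "R < norm x" for x
      using has_derivative_outside_support[OF der supp that] by simp
  qed auto
  have line: "((\<lambda>t. f (x + t *\<^sub>R v)) has_real_derivative f' (x + t *\<^sub>R v) v) (at t)" for x t
  proof -
    have "((\<lambda>t. x + t *\<^sub>R v) has_derivative (\<lambda>t. t *\<^sub>R v)) (at t)"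
      by (auto intro!: derivative_eq_intros)
    from has_derivative_compose[OF this der]
    show ?thesis
      using has_derivative_linear[OF der] unfolding has_field_derivative_def
      by (simp add: linear_scale mult_commute_abs)
  qed
  define h where "h n = 1 / real (Suc n)" for n
  have h: "0 < h n" "h n \<le> 1" for n by (simp_all add: h_def)
  define F where "F n x = (f (x + h n *\<^sub>R v) - f x) / h n" for n x
  have F0: "(LINT x|lborel. F n x) = 0" for n
    unfolding F_def using int by (simp add: lborel_integral_shift)
  have "(\<lambda>n. LINT x|lborel. F n x) \<longlonglongrightarrow> (LINT x|lborel. f' x v)"
  proof (rule integral_dominated_convergence)
    show "integrable lborel (\<lambda>x. B * indicator (cball 0 (R + norm v)) x)"
      by (intro integrable_mult_right integrable_real_indicator)
        (auto intro: emeasure_bounded_finite[unfolded infinity_ennreal_def])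
    show "AE x in lborel. (\<lambda>n. F n x) \<longlonglongrightarrow> f' x v"
    proof (rule AE_I2)
      fix x
      have "((\<lambda>t. (f (x + t *\<^sub>R v) - f x) / t) \<longlongrightarrow> f' x v) (at 0)"
        using line[of x 0] by (simp add: DERIV_def)
      moreover have "filterlim h (at 0) sequentially"
        unfolding filterlim_at h_def using LIMSEQ_Suc[OF lim_const_over_n[of 1]] by auto
      ultimately show "(\<lambda>n. F n x) \<longlonglongrightarrow> f' x v"
        unfolding F_def by (rule filterlim_compose)
    qed
    show "AE x in lborel. norm (F n x) \<le> B * indicator (cball 0 (R + norm v)) x" for n
    proof (rule AE_I2)
      fix x
      show "norm (F n x) \<le> B * indicator (cball 0 (R + norm v)) x"
      proof (cases "norm x \<le> R + norm v")
        case True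
        have "norm (f (x + h n *\<^sub>R v) - f (x + 0 *\<^sub>R v)) \<le> B * norm (h n - 0)"
          by (rule field_differentiable_bound[of UNIV "\<lambda>t. f (x + t *\<^sub>R v)" "\<lambda>t. f' (x + t *\<^sub>R v) v"])
            (use line B in auto)
        then show ?thesis
          using True h[of n] by (simp add: F_def field_simps)
      next
        case False
        have "norm x \<le> norm (x + h n *\<^sub>R v) + norm (h n *\<^sub>R v)"
          using norm_triangle_ineq4[of "x + h n *\<^sub>R v" "h n *\<^sub>R v"] by simp
        moreover have "norm (h n *\<^sub>R v) \<le> norm v"
          using h[of n] by (simp add: mult_left_le_one_le)
        ultimately have "R < norm (x + h n *\<^sub>R v)" using False by simp
        moreover have "R < norm x" using False norm_ge_zero[of v] by linarith
        ultimately show ?thesis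
          using supp B(1) by (simp add: F_def)
      qed
    qed
  qed (auto simp: F_def)
  then show ?thesis using F0 LIMSEQ_unique[OF _ tendsto_const[of 0]] by simp
qed

lemma Cc_infty_continuous: "\<phi> \<in> Cc_infty \<Longrightarrow> continuous_on UNIV \<phi>"
  by (metis (mono_tags, lifting) C_k.simps(1) Cc_infty_def mem_Collect_eq)

lemma Cc_infty_borel_measurable: "\<phi> \<in> Cc_infty \<Longrightarrow> \<phi> \<in> borel_measurable borel"
  by (intro borel_measurable_continuous_onI Cc_infty_continuous)

lemma Cc_infty_support:
  assumes "\<phi> \<in> Cc_infty"
  obtains R where "0 \<le> R" "\<And>z. R < norm z \<Longrightarrow> \<phi> z = 0"
proof -
  have "bounded {z. \<phi> z \<noteq> 0}"
    using assms by (simp add: Cc_infty_def compact_closure)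
  then obtain R where "\<And>z. \<phi> z \<noteq> 0 \<Longrightarrow> norm z \<le> R" "0 < R"
    unfolding bounded_pos by auto
  then show ?thesis using that[of R] by force
qed

lemma Cc_infty_has_derivative: "\<phi> \<in> Cc_infty \<Longrightarrow> (\<phi> has_derivative (\<lambda>h. h \<bullet> grad \<phi> z)) (at z)"
  by (rule C_k_Suc_has_derivative_grad[of 0]) (auto simp: Cc_infty_def simp del: C_k.simps)

lemma Cc_infty_continuous_grad: "\<phi> \<in> Cc_infty \<Longrightarrow> continuous_on UNIV (grad \<phi>)"
  by (rule C_1_continuous_grad) (auto simp: Cc_infty_def simp del: C_k.simps)

lemma Cc_infty_bounded:
  assumes "\<phi> \<in> Cc_infty"
  obtains M where "0 \<le> M" "\<And>z. \<bar>\<phi> z\<bar> \<le> M"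
proof -
  obtain R where R: "\<And>z. R < norm z \<Longrightarrow> \<phi> z = 0"
    using Cc_infty_support[OF assms] by metis
  show ?thesis
    by (rule continuous_compact_support_bounded[OF Cc_infty_continuous[OF assms] R])
      (auto intro: that)
qed

lemma Cc_infty_grad_outside:
  assumes "\<phi> \<in> Cc_infty" "\<And>z. R < norm z \<Longrightarrow> \<phi> z = 0" "R < norm z"
  shows "grad \<phi> z = 0"
proof -
  have "(\<lambda>h. h \<bullet> grad \<phi> z) = (\<lambda>h. 0)"
    by (rule has_derivative_outside_support[OF Cc_infty_has_derivative[OF assms(1)] assms(2,3)])
  then show ?thesis by (metis inner_eq_zero_iff)
qed

lemma Cc_infty_grad_bounded:
  assumes "\<phi> \<in> Cc_infty"
  obtains L where "0 \<le> L" "\<And>z. norm (grad \<phi> z) \<le> L"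
proof -
  obtain R where R: "\<And>z. R < norm z \<Longrightarrow> \<phi> z = 0"
    using Cc_infty_support[OF assms] by metis
  show ?thesis
  proof (rule continuous_compact_support_bounded[OF Cc_infty_continuous_grad[OF assms]])
    show "grad \<phi> z = 0" if "R < norm z" for z
      using Cc_infty_grad_outside[OF assms R that] .
  qed (rule that)
qed

lemma Cc_infty_lipschitz:
  assumes "\<phi> \<in> Cc_infty" and L: "\<And>z. norm (grad \<phi> z) \<le> L"
  shows "\<bar>\<phi> z - \<phi> w\<bar> \<le> L * norm (z - w)"
proof -
  have "norm (\<phi> z - \<phi> w) \<le> L * norm (z - w)"
  proof (rule differentiable_bound[of UNIV])
    show "(\<phi> has_derivative (\<lambda>h. h \<bullet> grad \<phi> z)) (at z within UNIV)" for z
      using Cc_infty_has_derivative[OF assms(1)] by simp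
    show "onorm (\<lambda>h. h \<bullet> grad \<phi> z) \<le> L" for z
    proof (rule onorm_le)
      fix h
      have "norm (h \<bullet> grad \<phi> z) \<le> norm h * norm (grad \<phi> z)"
        by (simp add: Cauchy_Schwarz_ineq2)
      also have "\<dots> \<le> L * norm h"
        using mult_left_mono[OF L[of z] norm_ge_zero[of h]] by (simp add: mult.commute)
      finally show "norm (h \<bullet> grad \<phi> z) \<le> L * norm h" .
    qed
  qed auto
  then show ?thesis by simp
qed

text \<open>The partial gradient in \<open>x\<close> is the first component of the full gradient, which makes the continuity and
  the boundedness of the transport term visible.\<close>

lemma transport_eq:
  assumes "\<phi> \<in> Cc_infty"
  shows "transport \<phi> z = snd z \<bullet> fst (grad \<phi> z)"
    and "((\<lambda>y. \<phi> (y, snd z)) has_derivative (\<lambda>h. h \<bullet> fst (grad \<phi> z))) (at (fst z))"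
proof -
  obtain x v where z: "z = (x, v)" by force
  have "((\<lambda>y. (y, v)) has_derivative (\<lambda>h. (h, 0))) (at x)"
    by (auto intro!: derivative_eq_intros)
  from has_derivative_compose[OF this Cc_infty_has_derivative[OF assms]]
  have *: "((\<lambda>y. \<phi> (y, v)) has_derivative (\<lambda>h. h \<bullet> fst (grad \<phi> (x, v)))) (at x)"
    by (simp add: inner_prod_def)
  then show "((\<lambda>y. \<phi> (y, snd z)) has_derivative (\<lambda>h. h \<bullet> fst (grad \<phi> z))) (at (fst z))"
    by (simp add: z)
  show "transport \<phi> z = snd z \<bullet> fst (grad \<phi> z)"
    by (simp add: transport_def z grad_eqI[OF *])
qed

text \<open>The difference of the two integrands is the derivative of \<open>x \<mapsto> \<phi> (x, v) * exp (- U x)\<close> in the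
  direction \<open>v\<close>.\<close>

lemma transport_integral_by_parts:
  fixes U :: "real ^ 'n \<Rightarrow> real"
  assumes U: "C_k 1 U" and phi: "\<phi> \<in> Cc_infty"
  shows "(LINT x|lborel. exp (- U x) * transport \<phi> (x, v)) =
    (LINT x|lborel. exp (- U x) * (\<phi> (x, v) * (grad U x \<bullet> v)))"
proof -
  obtain R where R: "\<And>z. R < norm z \<Longrightarrow> \<phi> z = 0"
    using Cc_infty_support[OF phi] by metis
  have supp: "\<phi> (x, v) = 0" "grad \<phi> (x, v) = 0" if "R < norm x" for x
    using R[of "(x, v)"] Cc_infty_grad_outside[OF phi R, where z = "(x, v)"] that norm_fst_le[of x v] by auto
  have U': "(U has_derivative (\<lambda>h. h \<bullet> grad U x)) (at x)" for x
    using U by (intro C_k_Suc_has_derivative_grad[of 0]) simp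
  note [continuous_intros] = continuous_on_compose2[OF C_1_continuous_grad[OF U]]
    continuous_on_compose2[OF Cc_infty_continuous_grad[OF phi]]
    continuous_on_compose2[OF Cc_infty_continuous[OF phi]]
  have "continuous_on UNIV U"
    using U C_k_Suc_imp_C_k[of 0 U] by simp
  note [continuous_intros] = continuous_on_compose2[OF this]
  define a where "a x = exp (- U x) * transport \<phi> (x, v)" for x
  define b where "b x = exp (- U x) * (\<phi> (x, v) * (grad U x \<bullet> v))" for x
  have cont: "continuous_on UNIV a" "continuous_on UNIV b"
    unfolding a_def b_def transport_eq(1)[OF phi] by (auto intro!: continuous_intros)
  have int: "integrable lborel a" "integrable lborel b"
    by (rule continuous_compact_support_integrable[OF cont(1), where R = R],
        simp add: a_def transport_eq(1)[OF phi] supp)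
      (rule continuous_compact_support_integrable[OF cont(2), where R = R],
        simp add: b_def supp)
  have "(LINT x|lborel. a x - b x) = 0"
  proof -
    let ?f' = "\<lambda>x h. exp (- U x) * (h \<bullet> fst (grad \<phi> (x, v))) - exp (- U x) * (\<phi> (x, v) * (h \<bullet> grad U x))"
    have "((\<lambda>x. \<phi> (x, v) * exp (- U x)) has_derivative ?f' x) (at x)" for x
      using transport_eq(2)[OF phi, of "(x, v)"] U'[of x]
      by (auto intro!: derivative_eq_intros simp: fun_eq_iff algebra_simps)
    moreover have "continuous_on UNIV (\<lambda>x. ?f' x v)"
      by (auto intro!: continuous_intros)
    ultimately have "(LINT x|lborel. ?f' x v) = 0"
      by (rule integral_directional_derivative_eq_0[where R = R]) (simp add: supp)
    then show ?thesis
      by (simp add: a_def b_def transport_eq(1)[OF phi] inner_commute)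
  qed
  then show ?thesis
    using int by (simp add: a_def[symmetric] b_def[symmetric])
qed

section \<open>Smooth approximation of boxes\<close>

text \<open>For \<open>m = 0\<close> this is the standard smooth function that is flat at the origin. The powers in the
  denominator are included because the whole family is then closed under differentiation.\<close>

definition flat :: "nat \<Rightarrow> real \<Rightarrow> real" where
  "flat m t = (if 0 < t then exp (- 1 / t) / t ^ m else 0)"

lemma flat_tendsto_0: "(flat m \<longlongrightarrow> 0) (at 0)"
proof -
  have "((\<lambda>t. inverse t ^ m / exp (inverse t)) \<longlongrightarrow> 0) (at_right (0::real))"
    by (rule filterlim_compose[OF tendsto_power_div_exp_0 filterlim_inverse_at_top_right])
  moreover have "eventually (\<lambda>t. inverse t ^ m / exp (inverse t) = flat m t) (at_right 0)"
    by (auto simp: flat_def eventually_at_filter exp_minus field_simps)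
  ultimately have "(flat m \<longlongrightarrow> 0) (at_right 0)"
    by (rule Lim_transform_eventually)
  moreover have "eventually (\<lambda>t. 0 = flat m t) (at_left 0)"
    by (auto simp: flat_def eventually_at_filter)
  then have "(flat m \<longlongrightarrow> 0) (at_left 0)"
    by (rule Lim_transform_eventually[OF tendsto_const])
  ultimately show ?thesis
    by (simp add: filterlim_at_split)
qed

lemma flat_has_derivative:
  "(flat m has_real_derivative flat (m + 2) t - real m * flat (m + 1) t) (at t)"
proof -
  consider "t > 0" | "t < 0" | "t = 0" by linarith
  then show ?thesis
  proof cases
    case 1
    have pow: "real m * t ^ (m - 1) * t = real m * t ^ m"
      by (cases m) auto
    have "((\<lambda>t. exp (- 1 / t) / t ^ m) has_real_derivative
        (exp (- 1 / t) * (1 / (t * t)) * t ^ m - exp (- 1 / t) * (real m * t ^ (m - 1))) / (t ^ m * t ^ m)) (at t)"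
      using 1 by (auto intro!: derivative_eq_intros)
    also have "(exp (- 1 / t) * (1 / (t * t)) * t ^ m - exp (- 1 / t) * (real m * t ^ (m - 1))) / (t ^ m * t ^ m) =
        exp (- 1 / t) / (t * t * t ^ m) - exp (- 1 / t) * (real m * t ^ (m - 1) * t) / (t * t ^ m * t ^ m)"
      using 1 by (simp add: diff_divide_distrib)
    also have "\<dots> = flat (m + 2) t - real m * flat (m + 1) t"
      using 1 unfolding pow by (simp add: flat_def mult_ac)
    finally have "((\<lambda>t. exp (- 1 / t) / t ^ m) has_real_derivative
        flat (m + 2) t - real m * flat (m + 1) t) (at t)" .
    then show ?thesis
      by (rule has_field_derivative_transform_within_open[where S = "{0<..}"]) (use 1 in \<open>auto simp: flat_def\<close>)
  next
    case 2
    have "((\<lambda>t. 0) has_real_derivative 0) (at t)" by simp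
    then have "(flat m has_real_derivative 0) (at t)"
      by (rule has_field_derivative_transform_within_open[where S = "{..<0}"]) (use 2 in \<open>auto simp: flat_def\<close>)
    then show ?thesis using 2 by (simp add: flat_def)
  next
    case 3
    have "(\<lambda>h. (flat m (0 + h) - flat m 0) / h) = flat (m + 1)"
      by (auto simp: flat_def fun_eq_iff)
    then show ?thesis
      using flat_tendsto_0[of "m + 1"] 3 by (simp add: DERIV_def flat_def)
  qed
qed

text \<open>Induction on \<open>k\<close> needs all \<open>m\<close> at once, since differentiation raises \<open>m\<close>.\<close>

lemma C_k_flat:
  assumes "\<And>k. C_k k f"
  shows "C_k k (\<lambda>x. flat m (f x))"
proof (induction k arbitrary: m)
  case 0
  have "continuous_on UNIV (flat m)"
    using flat_has_derivative DERIV_isCont by (blast intro: continuous_at_imp_continuous_on)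
  then show ?case
    using assms[of 0] by (auto intro: continuous_on_compose2)
next
  case (Suc k)
  define f' where "f' x = frechet_derivative f (at x)" for x
  have f': "(f has_derivative f' x) (at x)" for x
    unfolding f'_def by (rule C_k_Suc_has_derivative[OF assms[of "Suc k"]])
  have *: "((\<lambda>x. flat m (f x)) has_derivative
      (\<lambda>h. (flat (m + 2) (f x) - real m * flat (m + 1) (f x)) * f' x h)) (at x)" for x
    using has_derivative_compose[OF f' flat_has_derivative[of m "f x", unfolded has_field_derivative_def]]
    by simp
  have "C_k k (\<lambda>x. f' x b)" if "b \<in> Basis" for b
    using assms[of "Suc k"] that by (simp add: f'_def)
  then show ?case
    by (intro C_k_SucI[OF *] C_k_mult C_k_diff C_k_const Suc.IH)
qed

text \<open>Each factor is positive exactly when the coordinate of \<open>z\<close> lies strictly between those of \<open>a\<close> and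
  \<open>b\<close>. Multiplying the argument of \<open>flat 0\<close> by a growing constant moves its value
  \<open>exp (- 1 / (n t))\<close> up to \<open>1\<close>, so that the bumps increase to the indicator of the box. The factor is
  \<open>Suc n\<close> because \<open>n = 0\<close> would give the zero function.\<close>

definition bump :: "'a::euclidean_space \<Rightarrow> 'a \<Rightarrow> nat \<Rightarrow> 'a \<Rightarrow> real" where
  "bump a b n z = (\<Prod>i\<in>Basis. flat 0 (real (Suc n) * ((b \<bullet> i - z \<bullet> i) * (z \<bullet> i - a \<bullet> i))))"

lemma bump_nonneg: "0 \<le> bump a b n z"
  by (auto simp: bump_def flat_def intro!: prod_nonneg)

lemma bump_outside:
  assumes "\<And>i. i \<in> Basis \<Longrightarrow> a \<bullet> i < b \<bullet> i" "z \<notin> box a b"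
  shows "bump a b n z = 0"
proof -
  obtain i where i: "i \<in> Basis" "\<not> (a \<bullet> i < z \<bullet> i \<and> z \<bullet> i < b \<bullet> i)"
    using assms(2) by (auto simp: mem_box)
  then have "(b \<bullet> i - z \<bullet> i) * (z \<bullet> i - a \<bullet> i) \<le> 0"
    using assms(1)[of i] by (auto simp: mult_le_0_iff)
  then have "real (Suc n) * ((b \<bullet> i - z \<bullet> i) * (z \<bullet> i - a \<bullet> i)) \<le> 0"
    by (meson mult_nonneg_nonpos of_nat_0_le_iff)
  then show ?thesis
    unfolding bump_def using i(1) by (intro prod_zero bexI[of _ i]) (auto simp: flat_def not_less)
qed

lemma bump_inside:
  assumes "z \<in> box a b"
  shows "bump a b n z = exp (- (\<Sum>i\<in>Basis. 1 / ((b \<bullet> i - z \<bullet> i) * (z \<bullet> i - a \<bullet> i))) / real (Suc n))"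
proof -
  have "flat 0 (real (Suc n) * ((b \<bullet> i - z \<bullet> i) * (z \<bullet> i - a \<bullet> i))) =
      exp (- (1 / ((b \<bullet> i - z \<bullet> i) * (z \<bullet> i - a \<bullet> i))) / real (Suc n))" if "i \<in> Basis" for i
    using assms that by (simp add: flat_def mem_box zero_less_mult_iff mult_ac del: of_nat_Suc)
  then show ?thesis
    by (simp add: bump_def exp_sum[symmetric] sum_divide_distrib sum_negf del: of_nat_Suc)
qed

lemma bump_Cc_infty:
  assumes "\<And>i. i \<in> Basis \<Longrightarrow> a \<bullet> i < b \<bullet> i"
  shows "bump a b n \<in> Cc_infty"
proof -
  have "C_k k (bump a b n)" for k
    unfolding bump_def
    by (intro C_k_prod C_k_flat C_k_mult C_k_diff C_k_const C_k_inner) auto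
  moreover have "{z. bump a b n z \<noteq> 0} \<subseteq> box a b"
    using bump_outside[OF assms] by blast
  then have "bounded {z. bump a b n z \<noteq> 0}"
    by (rule bounded_subset[OF bounded_box])
  then have "compact (closure {z. bump a b n z \<noteq> 0})"
    by (simp add: compact_closure)
  ultimately show ?thesis
    by (simp add: Cc_infty_def)
qed

lemma bump_tendsto_indicator:
  assumes "\<And>i. i \<in> Basis \<Longrightarrow> a \<bullet> i < b \<bullet> i"
  shows "(\<lambda>n. bump a b n z) \<longlonglongrightarrow> indicator (box a b) z"
proof (cases "z \<in> box a b")
  case True
  let ?c = "- (\<Sum>i\<in>Basis. 1 / ((b \<bullet> i - z \<bullet> i) * (z \<bullet> i - a \<bullet> i)))"
  have "(\<lambda>n. exp (?c / real (Suc n))) \<longlonglongrightarrow> exp 0"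
    by (rule tendsto_exp) (rule LIMSEQ_Suc[OF lim_const_over_n])
  then show ?thesis using True by (simp only: bump_inside indicator_simps exp_zero)
qed (simp add: bump_outside[OF assms])

lemma bump_mono:
  assumes "\<And>i. i \<in> Basis \<Longrightarrow> a \<bullet> i < b \<bullet> i"
  shows "incseq (\<lambda>n. bump a b n z)"
proof (cases "z \<in> box a b")
  case True
  have "0 \<le> (\<Sum>i\<in>Basis. 1 / ((b \<bullet> i - z \<bullet> i) * (z \<bullet> i - a \<bullet> i)))"
    using True by (intro sum_nonneg) (auto simp: mem_box intro!: mult_nonneg_nonneg less_imp_le)
  then show ?thesis
    using True by (auto intro!: incseq_SucI divide_left_mono simp: bump_inside minus_divide_left[symmetric])
qed (simp add: bump_outside[OF assms])

text \<open>Open boxes generate the Borel sets and are closed under intersection, so it suffices to compare the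
  measures of boxes; these are limits of integrals of bumps by monotone convergence.\<close>

lemma finite_measure_eqI_Cc_infty:
  fixes M N :: "'a::euclidean_space measure"
  assumes [measurable_cong]: "sets M = sets borel" "sets N = sets borel" and "finite_measure M"
    and eq: "\<And>\<phi>. \<phi> \<in> Cc_infty \<Longrightarrow> (\<And>z. 0 \<le> \<phi> z) \<Longrightarrow> (\<integral>\<^sup>+z. \<phi> z \<partial>M) = (\<integral>\<^sup>+z. \<phi> z \<partial>N)"
  shows "M = N"
proof (rule measure_eqI_generator_eq)
  let ?E = "range (\<lambda>(a, b). box a b :: 'a set)"
  let ?A = "\<lambda>n::nat. box (- (real n *\<^sub>R One)) (real n *\<^sub>R One) :: 'a set"
  show "Int_stable ?E"
    unfolding Int_stable_def box_eq_empty by (auto simp: box_Int_box)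
  show "?E \<subseteq> Pow UNIV" by simp
  show "sets M = sigma_sets UNIV ?E" "sets N = sigma_sets UNIV ?E"
    using assms by (simp_all add: borel_eq_box)
  show "range ?A \<subseteq> ?E" by auto
  show "(\<Union>n. ?A n) = UNIV" by (rule UN_box_eq_UNIV)
  show "emeasure M (?A n) \<noteq> \<infinity>" for n
    using \<open>finite_measure M\<close> by (simp add: finite_measure.emeasure_finite)
  fix X assume "X \<in> ?E"
  then obtain a b where X: "X = box a b" by auto
  show "emeasure M X = emeasure N X"
  proof (cases "X = {}")
    case False
    then have ab: "a \<bullet> i < b \<bullet> i" if "i \<in> Basis" for i
      using X that by (auto simp: box_eq_empty not_le)
    have lim: "(\<lambda>n. \<integral>\<^sup>+z. bump a b n z \<partial>L) \<longlonglongrightarrow> emeasure L X"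
      if [measurable_cong]: "sets L = sets borel" for L
    proof -
      have [measurable]: "bump a b n \<in> borel_measurable borel" for n
        by (intro Cc_infty_borel_measurable bump_Cc_infty ab)
      have "(\<lambda>n. \<integral>\<^sup>+z. bump a b n z \<partial>L) \<longlonglongrightarrow> (\<integral>\<^sup>+z. indicator X z \<partial>L)"
      proof (rule nn_integral_LIMSEQ)
        show "incseq (\<lambda>n z. ennreal (bump a b n z))"
          using bump_mono[OF ab] by (auto simp: incseq_def le_fun_def ennreal_leI)
        show "(\<lambda>n. ennreal (bump a b n z)) \<longlonglongrightarrow> indicator X z" for z
          using tendsto_ennrealI[OF bump_tendsto_indicator[OF ab, of z]]
          by (simp add: X ennreal_indicator)
      qed auto
      then show ?thesis using X that by simp
    qed
    have "(\<integral>\<^sup>+z. bump a b n z \<partial>M) = (\<integral>\<^sup>+z. bump a b n z \<partial>N)" for n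
      by (intro eq bump_Cc_infty ab bump_nonneg)
    then show ?thesis
      using lim[OF assms(1)] lim[OF assms(2)] LIMSEQ_unique by auto
  qed simp
qed

section \<open>Gaussian measures and the exchange involution\<close>

lemma std_normal_density_integral: "(\<integral>\<^sup>+x. ennreal (std_normal_density x) \<partial>lborel) = 1"
  using std_normal_moment_even[of 0] by (simp add: nn_integral_eq_integral has_bochner_integral_iff)

lemma prob_space_std_gauss1: "prob_space std_gauss1"
  by (rule prob_spaceI) (simp add: std_gauss1_def emeasure_density std_normal_density_integral)

lemma sets_std_gauss1 [simp, measurable_cong]: "sets std_gauss1 = sets borel"
  by (simp add: std_gauss1_def)

lemma space_std_gauss1 [simp]: "space std_gauss1 = UNIV"
  by (simp add: std_gauss1_def)

lemma sets_std_gauss [simp, measurable_cong]: "sets std_gauss = sets borel"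
  by (simp add: std_gauss_def)

lemma space_std_gauss [simp]: "space std_gauss = UNIV"
  by (simp add: std_gauss_def)

lemma std_gauss1_moments:
  "integrable std_gauss1 (\<lambda>g. g)" "(LINT g|std_gauss1. g) = 0"
  "integrable std_gauss1 (\<lambda>g. g\<^sup>2)" "(LINT g|std_gauss1. g\<^sup>2) = 1"
  using std_normal_moment_odd[of 0] std_normal_moment_even[of 1]
  by (simp_all add: std_gauss1_def integrable_density integral_density has_bochner_integral_iff)

text \<open>Both the Gaussian density and the integrand are products over the coordinates, so the integral
  factorises.\<close>

lemma nn_integral_std_gauss_prod:
  fixes f :: "real \<Rightarrow> real"
  assumes [measurable]: "f \<in> borel_measurable borel" and nn: "\<And>x. 0 \<le> f x"
  shows "(\<integral>\<^sup>+v. ennreal (\<Prod>i\<in>UNIV. f (v $ i)) \<partial>(std_gauss :: (real ^ 'n) measure)) =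
    (\<integral>\<^sup>+x. ennreal (f x) \<partial>std_gauss1) ^ CARD('n)"
proof -
  let ?h = "\<lambda>x. std_normal_density x * f x"
  have basis: "(\<Prod>b\<in>Basis. ?h (v \<bullet> b)) = (\<Prod>i\<in>UNIV. ?h (v $ i))" for v :: "real ^ 'n"
  proof -
    have B: "Basis = range (\<lambda>i. axis i 1 :: real ^ 'n)"
      by (auto simp: Basis_vec_def)
    have "inj (\<lambda>i. axis i 1 :: real ^ 'n)"
      by (auto simp: inj_on_def axis_eq_axis)
    then show ?thesis
      unfolding B by (subst prod.reindex) (simp_all add: inner_axis o_def)
  qed
  have "(\<integral>\<^sup>+v. ennreal (\<Prod>i\<in>UNIV. f (v $ i)) \<partial>(std_gauss :: (real ^ 'n) measure)) =
      (\<integral>\<^sup>+v. ennreal (\<Prod>i\<in>UNIV. std_normal_density (v $ i)) * ennreal (\<Prod>i\<in>UNIV. f (v $ i)) \<partial>(lborel :: (real ^ 'n) measure))"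
    unfolding std_gauss_def by (rule nn_integral_density) measurable
  also have "\<dots> = (\<integral>\<^sup>+v. (\<Prod>b\<in>Basis. ennreal (?h (v \<bullet> b))) \<partial>(lborel :: (real ^ 'n) measure))"
  proof (rule nn_integral_cong)
    fix v :: "real ^ 'n"
    have "(\<Prod>b\<in>Basis. ennreal (?h (v \<bullet> b))) = ennreal (\<Prod>b\<in>Basis. ?h (v \<bullet> b))"
      by (rule prod_ennreal) (simp add: nn)
    also have "\<dots> = ennreal ((\<Prod>i\<in>UNIV. std_normal_density (v $ i)) * (\<Prod>i\<in>UNIV. f (v $ i)))"
      by (subst basis) (simp only: prod.distrib)
    also have "\<dots> = ennreal (\<Prod>i\<in>UNIV. std_normal_density (v $ i)) * ennreal (\<Prod>i\<in>UNIV. f (v $ i))"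
      by (intro ennreal_mult prod_nonneg) (auto simp: nn)
    finally show "ennreal (\<Prod>i\<in>UNIV. std_normal_density (v $ i)) * ennreal (\<Prod>i\<in>UNIV. f (v $ i)) =
        (\<Prod>b\<in>Basis. ennreal (?h (v \<bullet> b)))" ..
  qed
  also have "\<dots> = (\<Prod>b\<in>(Basis :: (real ^ 'n) set). \<integral>\<^sup>+x. ennreal (?h x) \<partial>lborel)"
    by (rule nn_integral_lborel_prod) auto
  also have "(\<integral>\<^sup>+x. ennreal (?h x) \<partial>lborel) = (\<integral>\<^sup>+x. ennreal (f x) \<partial>std_gauss1)"
    unfolding std_gauss1_def by (subst nn_integral_density) (auto simp: ennreal_mult nn)
  finally show ?thesis by simp
qed

lemma prob_space_std_gauss: "prob_space (std_gauss :: (real ^ 'n) measure)"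
proof (rule prob_spaceI)
  have "(\<integral>\<^sup>+v. 1 \<partial>(std_gauss :: (real ^ 'n) measure)) = 1"
    using nn_integral_std_gauss_prod[where f = "\<lambda>_. 1"]
      prob_space.emeasure_space_1[OF prob_space_std_gauss1] by simp
  then show "emeasure std_gauss (space (std_gauss :: (real ^ 'n) measure)) = 1" by simp
qed

text \<open>Since \<open>1 + \<bar>v\<bar>\<^sup>2 \<le> (\<Prod>i. 1 + v\<^sub>i\<^sup>2)\<close>, integrability reduces to a product of one-dimensional second
  moments.\<close>

lemma std_gauss_second_moment: "integrable (std_gauss :: (real ^ 'n) measure) (\<lambda>v. 1 + (norm v)\<^sup>2)"
proof (rule Bochner_Integration.integrable_bound)
  have "(\<integral>\<^sup>+x. ennreal (1 + x\<^sup>2) \<partial>std_gauss1) < \<infinity>"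
    using std_gauss1_moments(3) prob_space.emeasure_space_1[OF prob_space_std_gauss1]
    by (subst nn_integral_eq_integral)
      (auto intro!: Bochner_Integration.integrable_add finite_measure.integrable_const
        prob_space.finite_measure prob_space_std_gauss1)
  then have "(\<integral>\<^sup>+v. ennreal (\<Prod>i\<in>UNIV. 1 + (v $ i)\<^sup>2) \<partial>(std_gauss :: (real ^ 'n) measure)) < \<infinity>"
    by (subst nn_integral_std_gauss_prod) (auto simp: power_less_top_ennreal)
  then show "integrable (std_gauss :: (real ^ 'n) measure) (\<lambda>v. \<Prod>i\<in>UNIV. 1 + (v $ i)\<^sup>2)"
    by (intro integrableI_nonneg) (auto simp: prod_nonneg)
  have "1 + (\<Sum>i\<in>I. (v $ i)\<^sup>2) \<le> (\<Prod>i\<in>I. 1 + (v $ i)\<^sup>2)" if "finite I" for v :: "real ^ 'n" and I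
    using that
  proof induction
    case (insert i I)
    have "1 * (v $ i)\<^sup>2 \<le> (\<Prod>i\<in>I. 1 + (v $ i)\<^sup>2) * (v $ i)\<^sup>2"
      by (intro mult_right_mono prod_ge_1) auto
    then show ?case using insert by (simp add: algebra_simps)
  qed simp
  then have le: "1 + (\<Sum>i\<in>UNIV. (v $ i)\<^sup>2) \<le> (\<Prod>i\<in>UNIV. 1 + (v $ i)\<^sup>2)" for v :: "real ^ 'n"
    by simp
  show "AE v in std_gauss. norm (1 + (norm v)\<^sup>2) \<le> norm (\<Prod>i\<in>UNIV. 1 + ((v :: real ^ 'n) $ i)\<^sup>2)"
  proof (rule AE_I2)
    fix v :: "real ^ 'n"
    have "norm (1 + (norm v)\<^sup>2) = 1 + (\<Sum>i\<in>UNIV. (v $ i)\<^sup>2)"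
      by (simp add: norm_vec_def L2_set_def sum_nonneg)
    also note le[of v]
    also have "(\<Prod>i\<in>UNIV. 1 + (v $ i)\<^sup>2) \<le> norm (\<Prod>i\<in>UNIV. 1 + (v $ i)\<^sup>2)"
      by simp
    finally show "norm (1 + (norm v)\<^sup>2) \<le> norm (\<Prod>i\<in>UNIV. 1 + (v $ i)\<^sup>2)" .
  qed
qed measurable

text \<open>Shears and the reflection of the last coordinate preserve Lebesgue measure, by Fubini and the
  invariance of Lebesgue measure on the fibres. Composing them gives the exchange map without any
  determinants.\<close>

lemma nn_integral_shear_snd:
  fixes f :: "'a::euclidean_space \<times> real \<Rightarrow> ennreal"
  assumes [measurable]: "f \<in> borel_measurable borel" "a \<in> borel_measurable borel"
  shows "(\<integral>\<^sup>+z. f (fst z, snd z + a (fst z)) \<partial>(lborel \<Otimes>\<^sub>M lborel)) = (\<integral>\<^sup>+z. f z \<partial>(lborel \<Otimes>\<^sub>M lborel))"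
proof -
  have [measurable]: "f \<in> borel_measurable (borel \<Otimes>\<^sub>M borel)" by (simp add: borel_prod)
  have "(\<integral>\<^sup>+g. f (v, g + a v) \<partial>lborel) = (\<integral>\<^sup>+g. f (v, g) \<partial>lborel)" for v
    by (subst lborel_distr_plus[symmetric, of "a v"]) (simp add: nn_integral_distr add.commute)
  then show ?thesis
    by (simp add: lborel.nn_integral_fst[symmetric])
qed

lemma nn_integral_reflect_snd:
  fixes f :: "'a::euclidean_space \<times> real \<Rightarrow> ennreal"
  assumes [measurable]: "f \<in> borel_measurable borel"
  shows "(\<integral>\<^sup>+z. f (fst z, - snd z) \<partial>(lborel \<Otimes>\<^sub>M lborel)) = (\<integral>\<^sup>+z. f z \<partial>(lborel \<Otimes>\<^sub>M lborel))"
proof -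
  have [measurable]: "f \<in> borel_measurable (borel \<Otimes>\<^sub>M borel)" by (simp add: borel_prod)
  have "(\<integral>\<^sup>+g. f (v, - g) \<partial>lborel) = (\<integral>\<^sup>+g. f (v, g) \<partial>lborel)" for v
    by (subst lborel_distr_uminus[symmetric]) (simp add: nn_integral_distr)
  then show ?thesis
    by (simp add: lborel.nn_integral_fst[symmetric])
qed

lemma nn_integral_shear_fst:
  fixes f :: "'a::euclidean_space \<times> real \<Rightarrow> ennreal"
  assumes [measurable]: "f \<in> borel_measurable borel" "a \<in> borel_measurable borel"
  shows "(\<integral>\<^sup>+z. f (fst z + a (snd z), snd z) \<partial>(lborel \<Otimes>\<^sub>M lborel)) = (\<integral>\<^sup>+z. f z \<partial>(lborel \<Otimes>\<^sub>M lborel))"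
proof -
  have [measurable]: "f \<in> borel_measurable (borel \<Otimes>\<^sub>M borel)" by (simp add: borel_prod)
  have "(\<integral>\<^sup>+v. f (v + a g, g) \<partial>lborel) = (\<integral>\<^sup>+v. f (v, g) \<partial>lborel)" for g
    by (subst lborel_distr_plus[symmetric, of "a g"]) (simp add: nn_integral_distr add.commute)
  then show ?thesis
    by (simp add: lborel_pair.nn_integral_snd[symmetric])
qed

definition autoreg :: "real \<Rightarrow> 'a::real_inner \<Rightarrow> 'a \<Rightarrow> real \<Rightarrow> 'a" where
  "autoreg e T v g = v - (2 * e / (1 + e\<^sup>2) * (e * (v \<bullet> T) + g)) *\<^sub>R T"

text \<open>In the second component, \<open>- (g + e * (v \<bullet> T)) - e * (v' \<bullet> T)\<close> with \<open>v'\<close> the new velocity, is the noise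
  that leads back from \<open>v'\<close> to \<open>v\<close>. In terms of the shear \<open>S (v, g) = (v, g + e * (v \<bullet> T))\<close> and the
  involution \<open>N (v, g) = (v - (2 * e / (1 + e\<^sup>2) * g) *\<^sub>R T, - g)\<close>, the exchange map is the conjugate
  \<open>S\<^sup>-\<^sup>1 \<circ> N \<circ> S\<close>.\<close>

definition exchange :: "real \<Rightarrow> 'a::real_inner \<Rightarrow> 'a \<times> real \<Rightarrow> 'a \<times> real" where
  "exchange e T = (\<lambda>(v, g). (autoreg e T v g, - (g + e * (v \<bullet> T)) - e * (autoreg e T v g \<bullet> T)))"

lemma fst_exchange [simp]: "fst (exchange e T z) = autoreg e T (fst z) (snd z)"
  by (simp add: exchange_def case_prod_unfold)

lemma measurable_autoreg [measurable]:
  fixes f :: "'b \<Rightarrow> 'a::euclidean_space"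
  assumes [measurable]: "e \<in> borel_measurable M" "T \<in> borel_measurable M" "f \<in> borel_measurable M" "g \<in> borel_measurable M"
  shows "(\<lambda>z. autoreg (e z) (T z) (f z) (g z)) \<in> borel_measurable M"
  unfolding autoreg_def by measurable

lemma measurable_exchange [measurable]:
  "exchange e T \<in> borel_measurable (borel :: ('a::euclidean_space \<times> real) measure)"
  unfolding exchange_def borel_prod[symmetric] by measurable

text \<open>The innovation \<open>e * (v' \<bullet> T) + g'\<close> after the exchange is the negative of the one before it, so the
  second jump undoes the first.\<close>

lemma autoreg_exchange: "autoreg e T (fst (exchange e T z)) (snd (exchange e T z)) = fst z"
proof -
  obtain v g where z: "z = (v, g)" by force
  define v' where "v' = autoreg e T v g"
  have "e * (v' \<bullet> T) + (- (g + e * (v \<bullet> T)) - e * (v' \<bullet> T)) = - (e * (v \<bullet> T) + g)"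
    by simp
  then have "autoreg e T v' (- (g + e * (v \<bullet> T)) - e * (v' \<bullet> T)) =
      v' - (2 * e / (1 + e\<^sup>2) * (- (e * (v \<bullet> T) + g))) *\<^sub>R T"
    by (simp only: autoreg_def[of e T v'])
  also have "\<dots> = v"
    by (simp only: v'_def autoreg_def mult_minus_right scaleR_minus_left) simp
  finally show ?thesis
    by (simp add: z exchange_def v'_def)
qed

text \<open>Here the constants matter: for a unit vector \<open>T\<close> and \<open>k = 2 * e / (1 + e\<^sup>2)\<close>, the difference of the two
  sides is a multiple of \<open>k * (1 + e\<^sup>2) - 2 * e\<close>.\<close>

lemma exchange_norm:
  assumes "norm T = 1 \<or> T = 0"
  shows "(norm (fst (exchange e T z)))\<^sup>2 + (snd (exchange e T z))\<^sup>2 = (norm (fst z))\<^sup>2 + (snd z)\<^sup>2"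
proof (cases "T = 0")
  case False
  then have TT: "T \<bullet> T = 1" using assms by (simp add: norm_eq_1)
  obtain v g where z: "z = (v, g)" by force
  define s where "s = v \<bullet> T"
  define k where "k = 2 * e / (1 + e\<^sup>2)"
  define w where "w = e * s + g"
  have k: "k * (1 + e\<^sup>2) = 2 * e"
    unfolding k_def by (simp add: add_nonneg_eq_0_iff)
  have ar: "autoreg e T v g = v - (k * w) *\<^sub>R T"
    by (simp add: autoreg_def k_def w_def s_def)
  have arT: "autoreg e T v g \<bullet> T = s - k * w"
    by (simp add: ar inner_diff_left TT s_def)
  have sn: "snd (exchange e T z) = - w - e * (s - k * w)"
    by (simp add: exchange_def z arT w_def s_def[symmetric])
  have "(norm (autoreg e T v g))\<^sup>2 = v \<bullet> v - 2 * (k * w) * s + (k * w)\<^sup>2"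
    unfolding power2_norm_eq_inner ar
    by (simp add: inner_diff_left inner_diff_right TT inner_commute[of T v] s_def[symmetric] power2_eq_square algebra_simps)
  moreover have "- 2 * (k * w) * s + (k * w)\<^sup>2 + (- w - e * (s - k * w))\<^sup>2 = g\<^sup>2"
  proof -
    have g: "g = w - e * s" by (simp add: w_def)
    \<comment> \<open>Substituting \<open>g = w - e * s\<close> makes this a factorisation of a polynomial in \<open>k\<close>, \<open>e\<close>, \<open>w\<close>, \<open>s\<close>.\<close>
    have "- 2 * (k * w) * s + (k * w)\<^sup>2 + (- w - e * (s - k * w))\<^sup>2 - g\<^sup>2 =
        (k * (1 + e\<^sup>2) - 2 * e) * (k * w\<^sup>2 - 2 * w * s)"
      unfolding g by (simp add: power2_eq_square algebra_simps)
    then show ?thesis using k by simp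
  qed
  ultimately show ?thesis
    by (simp only: fst_exchange sn) (simp add: z power2_norm_eq_inner)
qed (simp add: exchange_def case_prod_unfold autoreg_def)

lemma nn_integral_exchange_lborel:
  fixes f :: "'a::euclidean_space \<times> real \<Rightarrow> ennreal"
  assumes [measurable]: "f \<in> borel_measurable borel"
  shows "(\<integral>\<^sup>+z. f (exchange e T z) \<partial>(lborel \<Otimes>\<^sub>M lborel)) = (\<integral>\<^sup>+z. f z \<partial>(lborel \<Otimes>\<^sub>M lborel))"
proof -
  have [measurable]: "f \<in> borel_measurable (borel \<Otimes>\<^sub>M borel)" by (simp add: borel_prod)
  define f1 where "f1 z = f (fst z, - snd z)" for z
  define f2 where "f2 z = f1 (fst z, snd z + e * (fst z \<bullet> T))" for z
  \<comment> \<open>Read from the inside, \<open>exchange e T\<close> is a shear of \<open>g\<close>, a shear of \<open>v\<close>, the first shear again, and a change of sign of \<open>g\<close>.\<close>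
  define f3 where "f3 z = f2 (fst z + (- (2 * e / (1 + e\<^sup>2)) * snd z) *\<^sub>R T, snd z)" for z
  have m: "f1 \<in> borel_measurable borel" "f2 \<in> borel_measurable borel" "f3 \<in> borel_measurable borel"
    unfolding f1_def f2_def f3_def borel_prod[symmetric] by measurable
  have "f (exchange e T z) = f3 (fst z, snd z + e * (fst z \<bullet> T))" for z
    by (simp add: f3_def f2_def f1_def exchange_def case_prod_unfold autoreg_def add.commute algebra_simps)
  then have "(\<integral>\<^sup>+z. f (exchange e T z) \<partial>(lborel \<Otimes>\<^sub>M lborel)) = (\<integral>\<^sup>+z. f3 z \<partial>(lborel \<Otimes>\<^sub>M lborel))"
    using nn_integral_shear_snd[OF m(3), of "\<lambda>v. e * (v \<bullet> T)"] by simp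
  also have "\<dots> = (\<integral>\<^sup>+z. f2 z \<partial>(lborel \<Otimes>\<^sub>M lborel))"
    unfolding f3_def by (rule nn_integral_shear_fst[OF m(2)]) measurable
  also have "\<dots> = (\<integral>\<^sup>+z. f1 z \<partial>(lborel \<Otimes>\<^sub>M lborel))"
    unfolding f2_def by (rule nn_integral_shear_snd[OF m(1)]) measurable
  also have "\<dots> = (\<integral>\<^sup>+z. f z \<partial>(lborel \<Otimes>\<^sub>M lborel))"
    unfolding f1_def by (rule nn_integral_reflect_snd) fact
  finally show ?thesis .
qed

lemma std_normal_density_prod:
  "(\<Prod>i\<in>UNIV. std_normal_density ((v :: real ^ 'n) $ i)) = (1 / sqrt (2 * pi)) ^ CARD('n) * exp (- (norm v)\<^sup>2 / 2)"
proof -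
  have "(\<Prod>i\<in>UNIV. exp (- (v $ i)\<^sup>2 / 2)) = exp (- (norm v)\<^sup>2 / 2)"
    by (simp add: exp_sum[symmetric] norm_vec_def L2_set_def sum_nonneg sum_divide_distrib[symmetric] sum_negf)
  then show ?thesis
    by (simp add: std_normal_density_def prod_dividef power_one_over)
qed

lemma gauss_pair_density:
  "(std_gauss :: (real ^ 'n) measure) \<Otimes>\<^sub>M std_gauss1 = density (lborel \<Otimes>\<^sub>M lborel)
    (\<lambda>z. ennreal ((1 / sqrt (2 * pi)) ^ (CARD('n) + 1) * exp (- ((norm (fst z))\<^sup>2 + (snd z)\<^sup>2) / 2)))"
proof -
  have "sigma_finite_measure (density lborel (\<lambda>g. ennreal (std_normal_density g)))"
    using prob_space_std_gauss1 by (simp add: std_gauss1_def prob_space_imp_sigma_finite)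
  then have "(std_gauss :: (real ^ 'n) measure) \<Otimes>\<^sub>M std_gauss1 = density (lborel \<Otimes>\<^sub>M lborel)
      (\<lambda>(v, g). ennreal (\<Prod>i\<in>UNIV. std_normal_density (v $ i)) * ennreal (std_normal_density g))"
    unfolding std_gauss_def std_gauss1_def
    by (intro pair_measure_density) (auto intro: sigma_finite_lborel)
  also have "(\<lambda>(v, g). ennreal (\<Prod>i\<in>UNIV. std_normal_density (v $ i)) * ennreal (std_normal_density g)) =
      (\<lambda>z :: (real ^ 'n) \<times> real.
        ennreal ((1 / sqrt (2 * pi)) ^ (CARD('n) + 1) * exp (- ((norm (fst z))\<^sup>2 + (snd z)\<^sup>2) / 2)))"
  proof
    fix z :: "(real ^ 'n) \<times> real"
    obtain v g where z: "z = (v, g)" by force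
    have "exp (- ((norm v)\<^sup>2 + g\<^sup>2) / 2) = exp (- (norm v)\<^sup>2 / 2) * exp (- g\<^sup>2 / 2)"
      by (simp add: exp_add[symmetric] add_divide_distrib)
    then have "(\<Prod>i\<in>UNIV. std_normal_density (v $ i)) * std_normal_density g =
        (1 / sqrt (2 * pi)) ^ (CARD('n) + 1) * exp (- ((norm v)\<^sup>2 + g\<^sup>2) / 2)"
      by (simp only: std_normal_density_prod) (simp add: std_normal_density_def mult_ac)
    then show "(case z of (v, g) \<Rightarrow> ennreal (\<Prod>i\<in>UNIV. std_normal_density (v $ i)) * ennreal (std_normal_density g)) =
        ennreal ((1 / sqrt (2 * pi)) ^ (CARD('n) + 1) * exp (- ((norm (fst z))\<^sup>2 + (snd z)\<^sup>2) / 2))"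
      by (simp only: z prod.case fst_conv snd_conv) (simp only: ennreal_mult[symmetric] prod_nonneg normal_density_nonneg)
  qed
  finally show ?thesis .
qed

text \<open>The Gaussian density depends only on the norm of \<open>(v, g)\<close>, which the exchange map preserves together
  with Lebesgue measure.\<close>

lemma nn_integral_exchange:
  fixes T :: "real ^ 'n"
  assumes "norm T = 1 \<or> T = 0" and [measurable]: "f \<in> borel_measurable borel"
  shows "(\<integral>\<^sup>+z. f (exchange e T z) \<partial>(std_gauss \<Otimes>\<^sub>M std_gauss1)) = (\<integral>\<^sup>+z. f z \<partial>(std_gauss \<Otimes>\<^sub>M std_gauss1))"
proof -
  define d :: "(real ^ 'n) \<times> real \<Rightarrow> ennreal" where
    "d z = ennreal ((1 / sqrt (2 * pi)) ^ (CARD('n) + 1) * exp (- ((norm (fst z))\<^sup>2 + (snd z)\<^sup>2) / 2))" for z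
  have [measurable]: "f \<in> borel_measurable (borel \<Otimes>\<^sub>M borel)" by (simp add: borel_prod)
  have [measurable]: "exchange e T \<in> borel \<Otimes>\<^sub>M borel \<rightarrow>\<^sub>M borel" by (simp add: borel_prod)
  have d[measurable]: "d \<in> borel_measurable (borel \<Otimes>\<^sub>M borel)"
    unfolding d_def by measurable
  have dens: "(std_gauss :: (real ^ 'n) measure) \<Otimes>\<^sub>M std_gauss1 = density (lborel \<Otimes>\<^sub>M lborel) d"
    unfolding d_def by (rule gauss_pair_density)
  have "d (exchange e T z) = d z" for z
    by (simp only: d_def exchange_norm[OF assms(1)])
  then have "(\<integral>\<^sup>+z. f (exchange e T z) \<partial>(std_gauss \<Otimes>\<^sub>M std_gauss1)) =
      (\<integral>\<^sup>+z. d (exchange e T z) * f (exchange e T z) \<partial>(lborel \<Otimes>\<^sub>M lborel))"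
    unfolding dens by (subst nn_integral_density) auto
  also have "\<dots> = (\<integral>\<^sup>+z. d z * f z \<partial>(lborel \<Otimes>\<^sub>M lborel))"
    using d by (intro nn_integral_exchange_lborel[where f = "\<lambda>z. d z * f z"]) (simp add: borel_prod)
  also have "\<dots> = (\<integral>\<^sup>+z. f z \<partial>(std_gauss \<Otimes>\<^sub>M std_gauss1))"
    unfolding dens by (subst nn_integral_density) auto
  finally show ?thesis .
qed

text \<open>Detailed balance for the autoregression: the exchange map turns the pair \<open>(v, v')\<close> into \<open>(v', v)\<close>.\<close>

lemma autoreg_pair_swap:
  fixes T :: "real ^ 'n"
  assumes "norm T = 1 \<or> T = 0"
  shows "distr (std_gauss \<Otimes>\<^sub>M std_gauss1) borel (\<lambda>z. (fst z, autoreg e T (fst z) (snd z))) =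
    distr (std_gauss \<Otimes>\<^sub>M std_gauss1) borel (\<lambda>z. (autoreg e T (fst z) (snd z), fst z))" (is "?L = ?R")
proof (rule measure_eqI)
  fix A assume "A \<in> sets ?L"
  then have A: "A \<in> sets (borel \<Otimes>\<^sub>M borel)" by (simp only: sets_distr borel_prod)
  have [measurable]: "(\<lambda>z. (fst z, autoreg e T (fst z) (snd z))) \<in> std_gauss \<Otimes>\<^sub>M std_gauss1 \<rightarrow>\<^sub>M borel"
    "(\<lambda>z. (autoreg e T (fst z) (snd z), fst z)) \<in> std_gauss \<Otimes>\<^sub>M std_gauss1 \<rightarrow>\<^sub>M borel"
    unfolding borel_prod[symmetric] by measurable
  define f :: "(real ^ 'n) \<times> real \<Rightarrow> ennreal" where "f z = indicator A (autoreg e T (fst z) (snd z), fst z)" for z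
  have f: "f \<in> borel_measurable borel"
    unfolding f_def borel_prod[symmetric] using A by measurable
  have em: "emeasure (distr M borel h) A = (\<integral>\<^sup>+z. indicator A (h z) \<partial>M)"
    if "h \<in> M \<rightarrow>\<^sub>M borel" for M and h :: "(real ^ 'n) \<times> real \<Rightarrow> (real ^ 'n) \<times> (real ^ 'n)"
  proof -
    have "emeasure (distr M borel h) A = (\<integral>\<^sup>+z. indicator A z \<partial>distr M borel h)"
      using A by (intro nn_integral_indicator[symmetric]) (simp only: sets_distr borel_prod)
    also have "\<dots> = (\<integral>\<^sup>+z. indicator A (h z) \<partial>M)"
      using A that by (intro nn_integral_distr borel_measurable_indicator) (simp_all only: sets_distr borel_prod)
    finally show ?thesis .
  qed
  have "f (exchange e T z) = indicator A (fst z, autoreg e T (fst z) (snd z))" for z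
    by (simp only: f_def autoreg_exchange) simp
  then show "emeasure ?L A = emeasure ?R A"
    using nn_integral_exchange[OF assms f, of e]
    by (simp add: em) (simp add: f_def case_prod_unfold)
qed simp

section \<open>Reversibility and the average condition\<close>

lemma refreshed_eq_autoreg: "refreshed U \<epsilon> x v g = autoreg (\<epsilon> x) (unit_grad U x) v g"
  by (simp add: refreshed_def autoreg_def)

lemma unit_grad_norm: "norm (unit_grad U x) = 1 \<or> unit_grad U x = 0"
  by (simp add: unit_grad_def)

lemma grad_along_unit_grad: "(grad U x \<bullet> unit_grad U x) *\<^sub>R unit_grad U x = grad U x"
  by (simp add: unit_grad_def dot_square_norm power2_eq_square)

lemma measurable_unit_grad:
  assumes [measurable]: "grad U \<in> borel_measurable borel"
  shows "unit_grad U \<in> borel_measurable borel"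
  unfolding unit_grad_def by measurable

text \<open>Writing the scaling factor as a constant density makes the standard rules for Bochner integrals over
  densities applicable.\<close>

lemma q0_eq_density:
  "q0 U \<epsilon> x v = density (distr std_gauss1 borel (autoreg (\<epsilon> x) (unit_grad U x) v))
    (\<lambda>_. ennreal ((1 + (\<epsilon> x)\<^sup>2) / (\<epsilon> x)\<^sup>2))"
  unfolding q0_def refreshed_eq_autoreg
  by (rule measure_eqI) (auto simp: emeasure_density nn_integral_cmult_indicator)

lemma sets_q0 [simp, measurable_cong]: "sets (q0 U \<epsilon> x v) = sets borel"
  by (simp add: q0_def)

lemma measurable_autoreg_gauss [measurable]:
  "autoreg e T (v :: 'a::euclidean_space) \<in> borel_measurable borel"
  unfolding autoreg_def[abs_def] by measurable

lemma nn_integral_q0: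
  assumes [measurable]: "F \<in> borel_measurable borel"
  shows "(\<integral>\<^sup>+v'. F v' \<partial>q0 U \<epsilon> x v) = ennreal ((1 + (\<epsilon> x)\<^sup>2) / (\<epsilon> x)\<^sup>2) *
    (\<integral>\<^sup>+g. F (autoreg (\<epsilon> x) (unit_grad U x) v g) \<partial>std_gauss1)"
  unfolding q0_eq_density
  by (simp add: nn_integral_density nn_integral_distr nn_integral_cmult)

lemma integral_q0:
  fixes F :: "real ^ 'n \<Rightarrow> 'b::{banach, second_countable_topology}"
  assumes [measurable]: "F \<in> borel_measurable borel"
  shows "(LINT v'|q0 U \<epsilon> x v. F v') = ((1 + (\<epsilon> x)\<^sup>2) / (\<epsilon> x)\<^sup>2) *\<^sub>R
    (LINT g|std_gauss1. F (autoreg (\<epsilon> x) (unit_grad U x) v g))"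
  unfolding q0_eq_density
  by (simp add: integral_density integral_distr)

lemma autoreg_affine:
  "autoreg e T v g = (v - (2 * e / (1 + e\<^sup>2) * (e * (v \<bullet> T))) *\<^sub>R T) - g *\<^sub>R ((2 * e / (1 + e\<^sup>2)) *\<^sub>R T)"
  by (simp add: autoreg_def distrib_left scaleR_add_left add_divide_distrib mult.commute)

lemma autoreg_mean:
  fixes T v :: "'a::euclidean_space"
  shows "integrable std_gauss1 (autoreg e T v)"
    and "(LINT g|std_gauss1. autoreg e T v g) = v - (2 * e / (1 + e\<^sup>2) * (e * (v \<bullet> T))) *\<^sub>R T"
proof -
  interpret prob_space std_gauss1 by (rule prob_space_std_gauss1)
  show "integrable std_gauss1 (autoreg e T v)"
    unfolding autoreg_affine[abs_def]
    by (intro Bochner_Integration.integrable_diff integrable_const integrable_scaleR_left impI std_gauss1_moments)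
  show "(LINT g|std_gauss1. autoreg e T v g) = v - (2 * e / (1 + e\<^sup>2) * (e * (v \<bullet> T))) *\<^sub>R T"
    unfolding autoreg_affine
    by (subst Bochner_Integration.integral_diff)
      (auto simp: std_gauss1_moments prob_space[simplified])
qed

lemma transition_kernel_q0:
  fixes U :: "real ^ 'n \<Rightarrow> real"
  assumes [measurable]: "grad U \<in> borel_measurable borel" "\<epsilon> \<in> borel_measurable borel"
  shows "transition_kernel (q0 U \<epsilon>)"
  unfolding transition_kernel_def
proof (intro conjI allI ballI)
  fix A :: "(real ^ 'n) set" assume A[measurable]: "A \<in> sets borel"
  interpret prob_space std_gauss1 by (rule prob_space_std_gauss1)
  note [measurable] = measurable_unit_grad[OF assms(1)]
  have "emeasure (q0 U \<epsilon> (fst z) (snd z)) A = ennreal ((1 + (\<epsilon> (fst z))\<^sup>2) / (\<epsilon> (fst z))\<^sup>2) *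
      (\<integral>\<^sup>+g. indicator A (autoreg (\<epsilon> (fst z)) (unit_grad U (fst z)) (snd z) g) \<partial>std_gauss1)" for z
    by (subst nn_integral_q0[symmetric]) simp_all
  moreover have "(\<lambda>z. ennreal ((1 + (\<epsilon> (fst z))\<^sup>2) / (\<epsilon> (fst z))\<^sup>2) *
      (\<integral>\<^sup>+g. indicator A (autoreg (\<epsilon> (fst z)) (unit_grad U (fst z)) (snd z) g) \<partial>std_gauss1))
      \<in> borel_measurable (borel \<Otimes>\<^sub>M borel)"
    by measurable
  ultimately show "(\<lambda>(x, v). emeasure (q0 U \<epsilon> x v) A) \<in> borel_measurable borel"
    unfolding borel_prod case_prod_unfold by presburger
qed simp

lemma average_condition_q0:
  fixes U :: "real ^ 'n \<Rightarrow> real"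
  assumes pos: "\<And>x. \<epsilon> x > 0"
  shows "average_condition U (q0 U \<epsilon>)"
  unfolding average_condition_def
proof (intro conjI allI)
  interpret prob_space std_gauss1 by (rule prob_space_std_gauss1)
  fix x v :: "real ^ 'n"
  let ?ar = "autoreg (\<epsilon> x) (unit_grad U x) v"
  have "integrable std_gauss1 (\<lambda>g. 1 + norm (?ar g))"
    by (intro Bochner_Integration.integrable_add integrable_const integrable_norm autoreg_mean)
  then have "(\<integral>\<^sup>+g. ennreal (1 + norm (?ar g)) \<partial>std_gauss1) < \<infinity>"
    by (subst nn_integral_eq_integral) auto
  then show "(\<integral>\<^sup>+v'. ennreal (1 + norm v') \<partial>q0 U \<epsilon> x v) < \<infinity>"
    by (subst nn_integral_q0) (auto simp: ennreal_mult_less_top)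
next
  interpret prob_space std_gauss1 by (rule prob_space_std_gauss1)
  have "grad U x \<bullet> (LINT v'|q0 U \<epsilon> x v. (1/2) *\<^sub>R (v - v')) = grad U x \<bullet> v" for x v :: "real ^ 'n"
  proof -
    let ?T = "unit_grad U x" and ?e = "\<epsilon> x"
    have "(LINT v'|q0 U \<epsilon> x v. (1/2) *\<^sub>R (v - v')) =
        ((1 + ?e\<^sup>2) / ?e\<^sup>2) *\<^sub>R (LINT g|std_gauss1. (1/2) *\<^sub>R (v - autoreg ?e ?T v g))"
      by (rule integral_q0) measurable
    also have "(LINT g|std_gauss1. (1/2) *\<^sub>R (v - autoreg ?e ?T v g)) =
        (1/2) *\<^sub>R (v - (LINT g|std_gauss1. autoreg ?e ?T v g))"
      by (simp add: Bochner_Integration.integral_diff autoreg_mean(1) prob_space[simplified])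
    also have "\<dots> = (1/2 * (2 * ?e / (1 + ?e\<^sup>2) * (?e * (v \<bullet> ?T)))) *\<^sub>R ?T"
      by (simp add: autoreg_mean(2))
    also have "((1 + ?e\<^sup>2) / ?e\<^sup>2) *\<^sub>R (1/2 * (2 * ?e / (1 + ?e\<^sup>2) * (?e * (v \<bullet> ?T)))) *\<^sub>R ?T = (v \<bullet> ?T) *\<^sub>R ?T"
    proof -
      have "?e \<noteq> 0" "1 + ?e\<^sup>2 \<noteq> 0" using pos[of x] by (auto simp: add_nonneg_eq_0_iff)
      then have "(1 + ?e\<^sup>2) / ?e\<^sup>2 * (1/2 * (2 * ?e / (1 + ?e\<^sup>2) * (?e * (v \<bullet> ?T)))) = v \<bullet> ?T"
        by (simp add: divide_simps power2_eq_square)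
      then show ?thesis by simp
    qed
    also have "grad U x \<bullet> \<dots> = ((grad U x \<bullet> ?T) *\<^sub>R ?T) \<bullet> v"
      by (simp add: inner_commute mult.commute)
    also have "\<dots> = grad U x \<bullet> v"
      by (simp only: grad_along_unit_grad)
    finally show ?thesis .
  qed
  then show "AE (x, v) in lborel \<Otimes>\<^sub>M std_gauss. grad U x \<bullet> (LINT v'|q0 U \<epsilon> x v. (1/2) *\<^sub>R (v - v')) = grad U x \<bullet> v"
    by simp
qed

lemma nn_integral_autoreg_swap:
  fixes T :: "real ^ 'n"
  assumes "norm T = 1 \<or> T = 0" and F: "F \<in> borel_measurable (borel :: ((real ^ 'n) \<times> (real ^ 'n)) measure)"
  shows "(\<integral>\<^sup>+z. F (fst z, autoreg e T (fst z) (snd z)) \<partial>(std_gauss \<Otimes>\<^sub>M std_gauss1)) =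
    (\<integral>\<^sup>+z. F (autoreg e T (fst z) (snd z), fst z) \<partial>(std_gauss \<Otimes>\<^sub>M std_gauss1))"
proof -
  have m: "(\<lambda>z. (fst z, autoreg e T (fst z) (snd z))) \<in> std_gauss \<Otimes>\<^sub>M std_gauss1 \<rightarrow>\<^sub>M borel"
    "(\<lambda>z. (autoreg e T (fst z) (snd z), fst z)) \<in> std_gauss \<Otimes>\<^sub>M std_gauss1 \<rightarrow>\<^sub>M borel"
    unfolding borel_prod[symmetric] by measurable
  show ?thesis
    using arg_cong[OF autoreg_pair_swap[OF assms(1), of e], of "\<lambda>M. integral\<^sup>N M F"] F
    by (simp add: nn_integral_distr[OF m(1)] nn_integral_distr[OF m(2)])
qed

lemma integral_autoreg_swap:
  fixes T :: "real ^ 'n" and F :: "(real ^ 'n) \<times> (real ^ 'n) \<Rightarrow> real"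
  assumes "norm T = 1 \<or> T = 0" and F: "F \<in> borel_measurable borel"
  shows "(LINT z|(std_gauss \<Otimes>\<^sub>M std_gauss1). F (fst z, autoreg e T (fst z) (snd z))) =
    (LINT z|(std_gauss \<Otimes>\<^sub>M std_gauss1). F (autoreg e T (fst z) (snd z), fst z))"
    and "integrable (std_gauss \<Otimes>\<^sub>M std_gauss1) (\<lambda>z. F (fst z, autoreg e T (fst z) (snd z))) \<longleftrightarrow>
      integrable (std_gauss \<Otimes>\<^sub>M std_gauss1) (\<lambda>z. F (autoreg e T (fst z) (snd z), fst z))"
proof -
  have m: "(\<lambda>z. (fst z, autoreg e T (fst z) (snd z))) \<in> std_gauss \<Otimes>\<^sub>M std_gauss1 \<rightarrow>\<^sub>M borel"
    "(\<lambda>z. (autoreg e T (fst z) (snd z), fst z)) \<in> std_gauss \<Otimes>\<^sub>M std_gauss1 \<rightarrow>\<^sub>M borel"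
    unfolding borel_prod[symmetric] by measurable
  show "(LINT z|(std_gauss \<Otimes>\<^sub>M std_gauss1). F (fst z, autoreg e T (fst z) (snd z))) =
    (LINT z|(std_gauss \<Otimes>\<^sub>M std_gauss1). F (autoreg e T (fst z) (snd z), fst z))"
    using arg_cong[OF autoreg_pair_swap[OF assms(1), of e], of "\<lambda>M. integral\<^sup>L M F"] F
    by (simp add: integral_distr[OF m(1)] integral_distr[OF m(2)])
  show "integrable (std_gauss \<Otimes>\<^sub>M std_gauss1) (\<lambda>z. F (fst z, autoreg e T (fst z) (snd z))) \<longleftrightarrow>
      integrable (std_gauss \<Otimes>\<^sub>M std_gauss1) (\<lambda>z. F (autoreg e T (fst z) (snd z), fst z))"
    using arg_cong[OF autoreg_pair_swap[OF assms(1), of e], of "\<lambda>M. integrable M F"] F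
    by (simp add: integrable_distr_eq[OF m(1)] integrable_distr_eq[OF m(2)])
qed

lemma reversible_q0: "reversible (q0 U \<epsilon>) (std_gauss :: (real ^ 'n) measure)"
  unfolding reversible_def
proof (intro allI ballI)
  interpret prob_space std_gauss1 by (rule prob_space_std_gauss1)
  fix x :: "real ^ 'n" and A :: "((real ^ 'n) \<times> (real ^ 'n)) set"
  assume A: "A \<in> sets borel"
  then have A2[measurable]: "A \<in> sets (borel \<Otimes>\<^sub>M borel)" by (simp only: borel_prod)
  let ?ar = "autoreg (\<epsilon> x) (unit_grad U x)" and ?c = "ennreal ((1 + (\<epsilon> x)\<^sup>2) / (\<epsilon> x)\<^sup>2)"
  have e1: "emeasure (q0 U \<epsilon> x v) {v'. (v, v') \<in> A} = ?c * (\<integral>\<^sup>+g. indicator A (v, ?ar v g) \<partial>std_gauss1)" for v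
  proof -
    have S: "{v'. (v, v') \<in> A} \<in> sets borel"
      using sets_Pair1[OF A2, of v] by (simp add: vimage_def)
    then have "emeasure (q0 U \<epsilon> x v) {v'. (v, v') \<in> A} = (\<integral>\<^sup>+v'. indicator {v'. (v, v') \<in> A} v' \<partial>q0 U \<epsilon> x v)"
      by simp
    also have "\<dots> = ?c * (\<integral>\<^sup>+g. indicator {v'. (v, v') \<in> A} (?ar v g) \<partial>std_gauss1)"
      using S by (intro nn_integral_q0) simp
    finally show ?thesis by (simp add: indicator_def)
  qed
  have e2: "emeasure (q0 U \<epsilon> x v) {v'. (v', v) \<in> A} = ?c * (\<integral>\<^sup>+g. indicator A (?ar v g, v) \<partial>std_gauss1)" for v
  proof -
    have S: "{v'. (v', v) \<in> A} \<in> sets borel"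
      using sets_Pair2[OF A2, of v] by (simp add: vimage_def)
    then have "emeasure (q0 U \<epsilon> x v) {v'. (v', v) \<in> A} = (\<integral>\<^sup>+v'. indicator {v'. (v', v) \<in> A} v' \<partial>q0 U \<epsilon> x v)"
      by simp
    also have "\<dots> = ?c * (\<integral>\<^sup>+g. indicator {v'. (v', v) \<in> A} (?ar v g) \<partial>std_gauss1)"
      using S by (intro nn_integral_q0) simp
    finally show ?thesis by (simp add: indicator_def)
  qed
  have i1: "(\<integral>\<^sup>+v. ?c * (\<integral>\<^sup>+g. indicator A (v, ?ar v g) \<partial>std_gauss1) \<partial>std_gauss) =
      ?c * (\<integral>\<^sup>+z. indicator A (fst z, ?ar (fst z) (snd z)) \<partial>(std_gauss \<Otimes>\<^sub>M std_gauss1))"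
    by (subst nn_integral_fst[symmetric]) (simp_all add: nn_integral_cmult)
  have i2: "(\<integral>\<^sup>+v. ?c * (\<integral>\<^sup>+g. indicator A (?ar v g, v) \<partial>std_gauss1) \<partial>std_gauss) =
      ?c * (\<integral>\<^sup>+z. indicator A (?ar (fst z) (snd z), fst z) \<partial>(std_gauss \<Otimes>\<^sub>M std_gauss1))"
    by (subst nn_integral_fst[symmetric]) (simp_all add: nn_integral_cmult)
  show "(\<integral>\<^sup>+v. emeasure (q0 U \<epsilon> x v) {v'. (v, v') \<in> A} \<partial>std_gauss) =
      (\<integral>\<^sup>+v'. emeasure (q0 U \<epsilon> x v') {v. (v, v') \<in> A} \<partial>std_gauss)"
    unfolding e1 e2 i1 i2
    using A by (subst nn_integral_autoreg_swap[OF unit_grad_norm]) auto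
qed

section \<open>Gaussian average of the jump part\<close>

lemma norm_le_1_plus_square: "norm v \<le> 1 + (norm v)\<^sup>2"
  using zero_le_power2[of "norm v - 1"] norm_ge_zero[of v] unfolding power2_diff power_one by linarith

text \<open>For fixed \<open>e\<close> the displacement \<open>v - v'\<close> is at most linear in \<open>\<bar>v\<bar>\<close> and \<open>\<bar>g\<bar>\<close>, which have finite
  first moments.\<close>

lemma integrable_autoreg_pair:
  fixes T :: "real ^ 'n" and F :: "(real ^ 'n) \<times> (real ^ 'n) \<Rightarrow> real"
  assumes F: "F \<in> borel_measurable borel" and T: "norm T \<le> 1"
    and bound: "\<And>v w. \<bar>F (v, w)\<bar> \<le> C * norm (v - w)"
  shows "integrable (std_gauss \<Otimes>\<^sub>M std_gauss1) (\<lambda>z. F (fst z, autoreg e T (fst z) (snd z)))"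
proof -
  interpret G: prob_space "std_gauss :: (real ^ 'n) measure" by (rule prob_space_std_gauss)
  interpret G1: prob_space std_gauss1 by (rule prob_space_std_gauss1)
  interpret P: pair_prob_space "std_gauss :: (real ^ 'n) measure" std_gauss1 ..
  let ?k = "2 * e / (1 + e\<^sup>2)"
  have [measurable]: "F \<in> borel_measurable (borel \<Otimes>\<^sub>M borel)"
    using F by (simp only: borel_prod)
  have absg: "integrable std_gauss1 (\<lambda>g. \<bar>g\<bar>)"
    using std_gauss1_moments(1) by (rule integrable_abs)
  have normv: "integrable (std_gauss :: (real ^ 'n) measure) (\<lambda>v. norm v)"
  proof (rule Bochner_Integration.integrable_bound[OF std_gauss_second_moment])
    show "AE v in std_gauss. norm (norm (v :: real ^ 'n)) \<le> norm (1 + (norm v)\<^sup>2)"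
      by (simp add: norm_le_1_plus_square)
  qed measurable
  have "integrable (std_gauss \<Otimes>\<^sub>M std_gauss1) (\<lambda>z :: (real ^ 'n) \<times> real. \<bar>C\<bar> * (\<bar>?k\<bar> * (\<bar>e\<bar> * norm (fst z) + \<bar>snd z\<bar>)))"
  proof (intro integrable_mult_right P.Fubini_integrable)
    show "integrable std_gauss (\<lambda>v :: real ^ 'n. LINT g|std_gauss1. norm (\<bar>e\<bar> * norm (fst (v, g)) + \<bar>snd (v, g)\<bar>))"
      using absg normv by (simp add: G1.prob_space[simplified])
    show "AE v in std_gauss. integrable std_gauss1 (\<lambda>g. \<bar>e\<bar> * norm (fst (v :: real ^ 'n, g)) + \<bar>snd (v, g)\<bar>)"
      using absg by simp
  qed measurable
  then show ?thesis
  proof (rule Bochner_Integration.integrable_bound)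
    have "norm (F (v, autoreg e T v g)) \<le> norm (\<bar>C\<bar> * (\<bar>?k\<bar> * (\<bar>e\<bar> * norm v + \<bar>g\<bar>)))" for v g
    proof -
      have w: "\<bar>e * (v \<bullet> T) + g\<bar> * norm T \<le> (\<bar>e\<bar> * norm v + \<bar>g\<bar>) * 1"
      proof (rule mult_mono)
        have "\<bar>v \<bullet> T\<bar> \<le> norm v * norm T" by (rule Cauchy_Schwarz_ineq2)
        also have "\<dots> \<le> norm v" using T by (simp add: mult_left_le)
        finally have "\<bar>e\<bar> * \<bar>v \<bullet> T\<bar> \<le> \<bar>e\<bar> * norm v" by (rule mult_left_mono) simp
        then show "\<bar>e * (v \<bullet> T) + g\<bar> \<le> \<bar>e\<bar> * norm v + \<bar>g\<bar>"
          using abs_triangle_ineq[of "e * (v \<bullet> T)" g] by (simp add: abs_mult)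
      qed (use T in auto)
      have "\<bar>F (v, autoreg e T v g)\<bar> \<le> C * norm (v - autoreg e T v g)" by (rule bound)
      also have "\<dots> \<le> \<bar>C\<bar> * norm (v - autoreg e T v g)" by (intro mult_right_mono) auto
      also have "\<dots> = \<bar>C\<bar> * (\<bar>?k\<bar> * (\<bar>e * (v \<bullet> T) + g\<bar> * norm T))"
        by (simp add: autoreg_def abs_mult)
      also have "\<dots> \<le> \<bar>C\<bar> * (\<bar>?k\<bar> * ((\<bar>e\<bar> * norm v + \<bar>g\<bar>) * 1))"
        by (intro mult_left_mono w abs_ge_zero)
      finally show ?thesis
        unfolding real_norm_def mult_1_right by (rule order_trans[OF _ abs_ge_self])
    qed
    then show "AE z in std_gauss \<Otimes>\<^sub>M std_gauss1. norm (F (fst z, autoreg e T (fst z) (snd z))) \<le>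
        norm (\<bar>C\<bar> * (\<bar>?k\<bar> * (\<bar>e\<bar> * norm (fst z) + \<bar>snd z\<bar>)))"
      by simp
  qed measurable
qed

text \<open>The hypothesis on \<open>u\<close> says that \<open>u\<close> is a multiple of the unit vector \<open>T\<close>, or that both vanish. With
  \<open>a (v, w)\<close> the jump integrand and \<open>d (v, w) = \<psi> v * (u \<bullet> (v - w))\<close>, the symmetrisations of \<open>a\<close> and of
  \<open>- d\<close> agree, and symmetrising does not change integrals over the exchangeable pair \<open>(v, v')\<close>. The
  integral of \<open>d\<close> over \<open>v'\<close> is linear, so that the average condition evaluates it.\<close>

lemma gauss_jump_integral:
  fixes T u :: "real ^ 'n" and \<psi> :: "real ^ 'n \<Rightarrow> real"
  assumes e: "e > 0" and T: "norm T = 1 \<or> T = 0" and u: "(u \<bullet> T) *\<^sub>R T = u"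
    and [measurable]: "\<psi> \<in> borel_measurable borel" and M: "\<And>v. \<bar>\<psi> v\<bar> \<le> M"
  shows "(LINT v|std_gauss. 1/2 * ((1 + e\<^sup>2) / e\<^sup>2 *
      (LINT g|std_gauss1. (\<psi> (autoreg e T v g) - \<psi> v) * max (u \<bullet> (v - autoreg e T v g)) 0))) =
    - (LINT v|std_gauss. \<psi> v * (u \<bullet> v))"
proof -
  interpret G: prob_space "std_gauss :: (real ^ 'n) measure" by (rule prob_space_std_gauss)
  interpret G1: prob_space std_gauss1 by (rule prob_space_std_gauss1)
  interpret P: pair_prob_space "std_gauss :: (real ^ 'n) measure" std_gauss1 ..
  let ?W = "(std_gauss :: (real ^ 'n) measure) \<Otimes>\<^sub>M std_gauss1"
  let ?r = "\<lambda>z. autoreg e T (fst z) (snd z)"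
  let ?k = "2 * e / (1 + e\<^sup>2)"
  have M0: "0 \<le> M" using M[of 0] by linarith
  have T1: "norm T \<le> 1" using T by auto
  define a where "a = (\<lambda>(v, w). (\<psi> w - \<psi> v) * max (u \<bullet> (v - w)) 0)"
  define d where "d = (\<lambda>(v, w). \<psi> v * (u \<bullet> (v - w)))"
  have meas: "a \<in> borel_measurable borel" "d \<in> borel_measurable borel"
    unfolding a_def d_def borel_prod[symmetric] by measurable
  have uvw: "\<bar>u \<bullet> (v - w)\<bar> \<le> norm u * norm (v - w)" for v w
    by (rule Cauchy_Schwarz_ineq2)
  have "\<bar>a (v, w)\<bar> \<le> (2 * M * norm u) * norm (v - w)" for v w
  proof -
    have "\<bar>\<psi> w - \<psi> v\<bar> * \<bar>max (u \<bullet> (v - w)) 0\<bar> \<le> (2 * M) * (norm u * norm (v - w))"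
      using M[of v] M[of w] uvw[of v w] by (intro mult_mono) auto
    then show ?thesis by (simp add: a_def abs_mult)
  qed
  then have ia: "integrable ?W (\<lambda>z. a (fst z, ?r z))"
    by (rule integrable_autoreg_pair[OF meas(1) T1])
  have "\<bar>d (v, w)\<bar> \<le> (M * norm u) * norm (v - w)" for v w
  proof -
    have "\<bar>\<psi> v\<bar> * \<bar>u \<bullet> (v - w)\<bar> \<le> M * (norm u * norm (v - w))"
      using M[of v] M0 uvw[of v w] by (intro mult_mono) auto
    then show ?thesis by (simp add: d_def abs_mult)
  qed
  then have id: "integrable ?W (\<lambda>z. d (fst z, ?r z))"
    by (rule integrable_autoreg_pair[OF meas(2) T1])
  note ia' = ia[unfolded integral_autoreg_swap(2)[OF T meas(1)]]
    and id' = id[unfolded integral_autoreg_swap(2)[OF T meas(2)]]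
  have "a (v, w) + a (w, v) = - d (v, w) - d (w, v)" for v w
    by (simp add: a_def d_def inner_diff_right max_def algebra_simps)
  then have "(LINT z|?W. a (fst z, ?r z) + a (?r z, fst z)) = (LINT z|?W. - d (fst z, ?r z) - d (?r z, fst z))"
    by presburger
  then have "2 * (LINT z|?W. a (fst z, ?r z)) = - 2 * (LINT z|?W. d (fst z, ?r z))"
    using ia id ia' id' integral_autoreg_swap(1)[OF T meas(1), of e] integral_autoreg_swap(1)[OF T meas(2), of e]
    by simp
  then have ad: "(LINT z|?W. a (fst z, ?r z)) = - (LINT z|?W. d (fst z, ?r z))" by simp
  have fa: "(LINT z|?W. a (fst z, ?r z)) = (LINT v|std_gauss. LINT g|std_gauss1. a (v, autoreg e T v g))"
    using P.integral_fst'[OF ia] by simp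
  have fd: "(LINT z|?W. d (fst z, ?r z)) = (LINT v|std_gauss. LINT g|std_gauss1. d (v, autoreg e T v g))"
    using P.integral_fst'[OF id] by simp
  have inner: "(LINT g|std_gauss1. d (v, autoreg e T v g)) = ?k * e * (\<psi> v * (u \<bullet> v))" for v
  proof -
    have "(LINT g|std_gauss1. d (v, autoreg e T v g)) = \<psi> v * (u \<bullet> (LINT g|std_gauss1. v - autoreg e T v g))"
      using autoreg_mean(1)[of e T v] by (simp add: d_def)
    also have "(LINT g|std_gauss1. v - autoreg e T v g) = (?k * (e * (v \<bullet> T))) *\<^sub>R T"
      using autoreg_mean[of e T v] by (simp add: G1.prob_space[simplified])
    also have "u \<bullet> \<dots> = ?k * e * (((u \<bullet> T) *\<^sub>R T) \<bullet> v)"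
      by (simp add: inner_commute[of T v])
    also have "\<dots> = ?k * e * (u \<bullet> v)" by (simp only: u)
    finally show ?thesis by simp
  qed
  have "(LINT v|std_gauss. 1/2 * ((1 + e\<^sup>2) / e\<^sup>2 *
      (LINT g|std_gauss1. (\<psi> (autoreg e T v g) - \<psi> v) * max (u \<bullet> (v - autoreg e T v g)) 0))) =
      1/2 * ((1 + e\<^sup>2) / e\<^sup>2 * (LINT z|?W. a (fst z, ?r z)))"
    unfolding fa by (simp add: a_def)
  also have "\<dots> = - (1/2 * ((1 + e\<^sup>2) / e\<^sup>2 * (?k * e * (LINT v|std_gauss. \<psi> v * (u \<bullet> v)))))"
    unfolding ad fd inner by simp
  also have "1/2 * ((1 + e\<^sup>2) / e\<^sup>2 * (?k * e * I)) = I" for I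
  proof -
    have "1 + e\<^sup>2 \<noteq> 0" by (simp add: add_nonneg_eq_0_iff)
    then show ?thesis using e by (simp add: divide_simps power2_eq_square)
  qed
  finally show ?thesis .
qed

lemma jump_q0:
  fixes \<phi> :: "(real ^ 'n) \<times> (real ^ 'n) \<Rightarrow> real"
  assumes phi: "\<phi> \<in> borel_measurable borel"
  shows "jump U (q0 U \<epsilon>) \<phi> (x, v) = 1/2 * ((1 + (\<epsilon> x)\<^sup>2) / (\<epsilon> x)\<^sup>2 *
    (LINT g|std_gauss1. (\<phi> (x, autoreg (\<epsilon> x) (unit_grad U x) v g) - \<phi> (x, v)) *
      max (grad U x \<bullet> (v - autoreg (\<epsilon> x) (unit_grad U x) v g)) 0))"
proof -
  have [measurable]: "\<phi> \<in> borel_measurable (borel \<Otimes>\<^sub>M borel)"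
    using phi by (simp only: borel_prod)
  have "(LINT v'|q0 U \<epsilon> x v. (\<phi> (x, v') - \<phi> (x, v)) * max (grad U x \<bullet> (v - v')) 0) =
      ((1 + (\<epsilon> x)\<^sup>2) / (\<epsilon> x)\<^sup>2) *\<^sub>R
      (LINT g|std_gauss1. (\<phi> (x, autoreg (\<epsilon> x) (unit_grad U x) v g) - \<phi> (x, v)) *
        max (grad U x \<bullet> (v - autoreg (\<epsilon> x) (unit_grad U x) v g)) 0)"
    by (rule integral_q0) measurable
  then show ?thesis by (simp add: jump_def)
qed

lemma measurable_jump_q0:
  fixes \<phi> :: "(real ^ 'n) \<times> (real ^ 'n) \<Rightarrow> real"
  assumes phi: "\<phi> \<in> borel_measurable borel"
    and [measurable]: "grad U \<in> borel_measurable borel" "\<epsilon> \<in> borel_measurable borel"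
  shows "jump U (q0 U \<epsilon>) \<phi> \<in> borel_measurable (borel \<Otimes>\<^sub>M borel)"
proof -
  interpret prob_space std_gauss1 by (rule prob_space_std_gauss1)
  note [measurable] = measurable_unit_grad[OF assms(2)]
  have [measurable]: "\<phi> \<in> borel_measurable (borel \<Otimes>\<^sub>M borel)"
    using phi by (simp only: borel_prod)
  have "jump U (q0 U \<epsilon>) \<phi> = (\<lambda>z. 1/2 * ((1 + (\<epsilon> (fst z))\<^sup>2) / (\<epsilon> (fst z))\<^sup>2 *
      (LINT g|std_gauss1. (\<phi> (fst z, autoreg (\<epsilon> (fst z)) (unit_grad U (fst z)) (snd z) g) - \<phi> (fst z, snd z)) *
        max (grad U (fst z) \<bullet> (snd z - autoreg (\<epsilon> (fst z)) (unit_grad U (fst z)) (snd z) g)) 0)))"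
  proof
    fix z :: "(real ^ 'n) \<times> (real ^ 'n)"
    show "jump U (q0 U \<epsilon>) \<phi> z = 1/2 * ((1 + (\<epsilon> (fst z))\<^sup>2) / (\<epsilon> (fst z))\<^sup>2 *
      (LINT g|std_gauss1. (\<phi> (fst z, autoreg (\<epsilon> (fst z)) (unit_grad U (fst z)) (snd z) g) - \<phi> (fst z, snd z)) *
        max (grad U (fst z) \<bullet> (snd z - autoreg (\<epsilon> (fst z)) (unit_grad U (fst z)) (snd z) g)) 0))"
      using jump_q0[OF phi, of U \<epsilon> "fst z" "snd z"] by simp
  qed
  also have "\<dots> \<in> borel_measurable (borel \<Otimes>\<^sub>M borel)"
    by measurable
  finally show ?thesis .
qed

text \<open>The Lipschitz bound contributes a second factor \<open>\<bar>v - v'\<bar>\<close> next to the one in the rate. Its square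
  compensates the mass \<open>(1 + e\<^sup>2) / e\<^sup>2\<close> of the kernel, so that the bound does not depend on \<open>e\<close>.\<close>

lemma jump_q0_bound:
  fixes \<phi> :: "(real ^ 'n) \<times> (real ^ 'n) \<Rightarrow> real"
  assumes phi: "\<phi> \<in> borel_measurable borel" and pos: "\<epsilon> x > 0"
    and lip: "\<And>v w. \<bar>\<phi> (x, v) - \<phi> (x, w)\<bar> \<le> L * norm (v - w)" and "0 \<le> L"
  shows "\<bar>jump U (q0 U \<epsilon>) \<phi> (x, v)\<bar> \<le> 2 * L * norm (grad U x) * (1 + (norm v)\<^sup>2)"
proof -
  interpret G1: prob_space std_gauss1 by (rule prob_space_std_gauss1)
  define e where "e = \<epsilon> x"
  define T where "T = unit_grad U x"
  define k where "k = 2 * e / (1 + e\<^sup>2)"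
  define c where "c = (1 + e\<^sup>2) / e\<^sup>2"
  define u where "u = grad U x"
  define s where "s = v \<bullet> T"
  define h where "h g = (\<phi> (x, autoreg e T v g) - \<phi> (x, v)) * max (u \<bullet> (v - autoreg e T v g)) 0" for g
  have e: "e > 0" using pos by (simp add: e_def)
  have [measurable]: "\<phi> \<in> borel_measurable (borel \<Otimes>\<^sub>M borel)"
    using phi by (simp only: borel_prod)
  have T1: "norm T \<le> 1" using unit_grad_norm[of U x] by (auto simp: T_def)
  have s: "\<bar>s\<bar> \<le> norm v"
    using Cauchy_Schwarz_ineq2[of v T] mult_left_mono[OF T1 norm_ge_zero[of v]] by (simp add: s_def)
  have i1: "integrable std_gauss1 (\<lambda>g. (e * s + g)\<^sup>2)"
    and v1: "(LINT g|std_gauss1. (e * s + g)\<^sup>2) = (e * s)\<^sup>2 + 1"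
    by (simp_all add: power2_sum std_gauss1_moments G1.prob_space[simplified])
  have hb: "norm (h g) \<le> L * norm u * k\<^sup>2 * (e * s + g)\<^sup>2" for g
  proof -
    let ?n = "norm (v - autoreg e T v g)"
    have n: "?n \<le> \<bar>k * (e * s + g)\<bar>"
      using mult_left_mono[OF T1 abs_ge_zero[of "k * (e * s + g)"]]
      by (simp add: autoreg_def k_def s_def)
    have "\<bar>\<phi> (x, autoreg e T v g) - \<phi> (x, v)\<bar> \<le> L * ?n"
      using lip[of "autoreg e T v g" v] by (simp add: norm_minus_commute[of v])
    moreover have "\<bar>max (u \<bullet> (v - autoreg e T v g)) 0\<bar> \<le> norm u * ?n"
      using Cauchy_Schwarz_ineq2[of u "v - autoreg e T v g"] by simp
    ultimately have "norm (h g) \<le> (L * ?n) * (norm u * ?n)"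
      unfolding h_def real_norm_def abs_mult using \<open>0 \<le> L\<close> by (intro mult_mono) auto
    also have "\<dots> = L * norm u * ?n\<^sup>2" by (simp add: power2_eq_square)
    also have "\<dots> \<le> L * norm u * \<bar>k * (e * s + g)\<bar>\<^sup>2"
      using \<open>0 \<le> L\<close> n by (intro mult_left_mono power_mono) auto
    finally show ?thesis by (simp add: power_mult_distrib mult.assoc)
  qed
  have ib: "integrable std_gauss1 (\<lambda>g. L * norm u * k\<^sup>2 * (e * s + g)\<^sup>2)"
    using i1 by simp
  have [measurable]: "h \<in> borel_measurable borel"
    unfolding h_def by measurable
  have ih: "integrable std_gauss1 h"
    by (rule Bochner_Integration.integrable_bound[OF ib])
      (auto intro!: AE_I2 order_trans[OF hb[unfolded real_norm_def] abs_ge_self])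
  have "norm (LINT g|std_gauss1. h g) \<le> (LINT g|std_gauss1. L * norm u * k\<^sup>2 * (e * s + g)\<^sup>2)"
    by (rule Bochner_Integration.integral_norm_bound_integral[OF ih ib hb])
  then have le: "\<bar>LINT g|std_gauss1. h g\<bar> \<le> L * norm u * k\<^sup>2 * ((e * s)\<^sup>2 + 1)"
    by (simp add: v1)
  have c0: "0 \<le> c" by (simp add: c_def)
  \<comment> \<open>This cancellation removes the singularity at \<open>e = 0\<close>.\<close>
  have ck: "c * k\<^sup>2 = 4 / (1 + e\<^sup>2)"
  proof -
    have "1 + e\<^sup>2 \<noteq> 0" by (simp add: add_nonneg_eq_0_iff)
    then show ?thesis using e by (simp add: c_def k_def divide_simps power2_eq_square)
  qed
  have "\<bar>jump U (q0 U \<epsilon>) \<phi> (x, v)\<bar> = 1/2 * (c * \<bar>LINT g|std_gauss1. h g\<bar>)"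
    unfolding jump_q0[OF phi] h_def c_def u_def T_def e_def by (simp add: abs_mult)
  also have "\<dots> \<le> 1/2 * (c * (L * norm u * k\<^sup>2 * ((e * s)\<^sup>2 + 1)))"
    using le c0 by (intro mult_left_mono) auto
  also have "\<dots> = 2 * L * norm u * (((e * s)\<^sup>2 + 1) / (1 + e\<^sup>2))"
  proof -
    have "1/2 * (c * (L * norm u * k\<^sup>2 * ((e * s)\<^sup>2 + 1))) = 1/2 * ((c * k\<^sup>2) * (L * norm u * ((e * s)\<^sup>2 + 1)))"
      by simp
    then show ?thesis unfolding ck by simp
  qed
  also have "\<dots> \<le> 2 * L * norm u * (1 + (norm v)\<^sup>2)"
  proof (rule mult_left_mono)
    have "s\<^sup>2 \<le> (norm v)\<^sup>2" using s by (simp add: abs_le_square_iff[symmetric])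
    then have "e\<^sup>2 * s\<^sup>2 \<le> e\<^sup>2 * (norm v)\<^sup>2" by (intro mult_left_mono) auto
    then have "(e * s)\<^sup>2 + 1 \<le> (1 + (norm v)\<^sup>2) * (1 + e\<^sup>2)"
      by (simp add: power_mult_distrib algebra_simps add_increasing)
    then show "((e * s)\<^sup>2 + 1) / (1 + e\<^sup>2) \<le> 1 + (norm v)\<^sup>2"
      by (simp add: pos_divide_le_eq add_pos_nonneg)
  qed (use \<open>0 \<le> L\<close> in auto)
  finally show ?thesis by (simp add: u_def)
qed

section \<open>The generator has mean zero under the target\<close>

locale velocity_jump =
  fixes U :: "real ^ 'n \<Rightarrow> real" and \<epsilon> :: "real ^ 'n \<Rightarrow> real"
  assumes U: "C_k 1 U"
    and exp_int: "integrable lborel (\<lambda>x. exp (- U x))"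
    and eps [measurable]: "\<epsilon> \<in> borel_measurable borel"
    and pos: "\<And>x. \<epsilon> x > 0"
begin

definition Z :: real where "Z = (LINT x|lborel. exp (- U x))"

lemma U_continuous: "continuous_on UNIV U"
  using U C_k_Suc_imp_C_k[of 0 U] by simp

lemma U_measurable [measurable]: "U \<in> borel_measurable borel"
  by (rule borel_measurable_continuous_onI[OF U_continuous])

lemma grad_measurable [measurable]: "grad U \<in> borel_measurable borel"
  by (rule borel_measurable_continuous_onI[OF C_1_continuous_grad[OF U]])

lemma Z_pos: "0 < Z"
proof -
  \<comment> \<open>The exponential is positive everywhere, whereas a vanishing integral would make it zero almost everywhere.\<close>
  have "Z \<noteq> 0"
  proof
    assume "Z = 0"
    then have "AE x in lborel. exp (- U x) = 0"
      using integral_nonneg_eq_0_iff_AE[OF exp_int] by (simp add: Z_def)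
    then have "AE x :: real ^ 'n in lborel. False" by simp
    then have "emeasure lborel (UNIV :: (real ^ 'n) set) = 0"
      by (simp add: AE_iff_measurable[of UNIV])
    then show False by simp
  qed
  moreover have "0 \<le> Z" unfolding Z_def by (rule Bochner_Integration.integral_nonneg) simp
  ultimately show ?thesis by simp
qed

sublocale gauss: prob_space "std_gauss :: (real ^ 'n) measure"
  by (rule prob_space_std_gauss)

sublocale phase: pair_sigma_finite "lborel :: (real ^ 'n) measure" "std_gauss :: (real ^ 'n) measure" ..

lemma target_eq: "target U = density (lborel \<Otimes>\<^sub>M std_gauss) (\<lambda>z. ennreal (exp (- U (fst z)) / Z))"
  by (simp add: target_def Z_def case_prod_unfold)

lemma sets_target: "sets (target U) = sets borel"
proof -
  have "sets (lborel \<Otimes>\<^sub>M std_gauss :: ((real ^ 'n) \<times> (real ^ 'n)) measure) = sets (borel \<Otimes>\<^sub>M borel)"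
    by (intro sets_pair_measure_cong) auto
  then show ?thesis by (simp only: target_eq sets_density borel_prod)
qed

lemma nn_integral_exp: "(\<integral>\<^sup>+x. ennreal (exp (- U x) / Z) \<partial>lborel) = 1"
  using exp_int Z_pos by (subst nn_integral_eq_integral) (auto simp: Z_def[symmetric])

text \<open>The velocity marginal of the target is Gaussian.\<close>

lemma nn_integral_target_snd:
  assumes [measurable]: "f \<in> borel_measurable borel"
  shows "(\<integral>\<^sup>+z. f (snd z) \<partial>target U) = (\<integral>\<^sup>+v. f v \<partial>std_gauss)"
proof -
  have "(\<integral>\<^sup>+z. f (snd z) \<partial>target U) = (\<integral>\<^sup>+z. ennreal (exp (- U (fst z)) / Z) * f (snd z) \<partial>(lborel \<Otimes>\<^sub>M std_gauss))"
    unfolding target_eq by (rule nn_integral_density) measurable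
  also have "\<dots> = (\<integral>\<^sup>+x. \<integral>\<^sup>+v. ennreal (exp (- U x) / Z) * f v \<partial>std_gauss \<partial>lborel)"
    by (subst gauss.nn_integral_fst[symmetric]) simp_all
  also have "\<dots> = (\<integral>\<^sup>+v. f v \<partial>std_gauss)"
    by (simp add: nn_integral_cmult nn_integral_multc nn_integral_exp)
  finally show ?thesis .
qed

lemma prob_space_target: "prob_space (target U)"
proof (rule prob_spaceI)
  have "(\<integral>\<^sup>+z. 1 \<partial>target U) = 1"
    using nn_integral_target_snd[of "\<lambda>_. 1"] gauss.emeasure_space_1 by simp
  then show "emeasure (target U) (space (target U)) = 1" by simp
qed

lemma integrable_target_bound:
  assumes f: "f \<in> borel_measurable (borel \<Otimes>\<^sub>M borel)" and bound: "\<And>z. \<bar>f z\<bar> \<le> C * (1 + (norm (snd z))\<^sup>2)"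
  shows "integrable (target U) f"
proof (rule Bochner_Integration.integrable_bound)
  have "(\<integral>\<^sup>+z. ennreal (1 + (norm (snd z))\<^sup>2) \<partial>target U) = (\<integral>\<^sup>+v. ennreal (1 + (norm v)\<^sup>2) \<partial>(std_gauss :: (real ^ 'n) measure))"
    by (rule nn_integral_target_snd[of "\<lambda>v. ennreal (1 + (norm v)\<^sup>2)"]) measurable
  also have "\<dots> < \<infinity>"
    by (subst nn_integral_eq_integral[OF std_gauss_second_moment]) auto
  finally have "(\<integral>\<^sup>+z. ennreal (1 + (norm (snd z))\<^sup>2) \<partial>target U) < \<infinity>" .
  moreover have "(\<lambda>z. 1 + (norm (snd z))\<^sup>2) \<in> borel_measurable (target U)"
    unfolding target_eq by measurable
  ultimately have "integrable (target U) (\<lambda>z. 1 + (norm (snd z))\<^sup>2)"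
    by (intro integrableI_nonneg) auto
  then show "integrable (target U) (\<lambda>z. C * (1 + (norm (snd z))\<^sup>2))"
    by (rule integrable_mult_right)
  show "f \<in> borel_measurable (target U)"
    using f sets_target by (simp only: borel_prod cong: measurable_cong_sets)
  show "AE z in target U. norm (f z) \<le> norm (C * (1 + (norm (snd z))\<^sup>2))"
    by (intro AE_I2) (simp only: real_norm_def order_trans[OF bound abs_ge_self])
qed

lemma integral_target:
  assumes [measurable]: "f \<in> borel_measurable (borel \<Otimes>\<^sub>M borel)"
  shows "(LINT z|target U. f z) = (LINT z|(lborel \<Otimes>\<^sub>M std_gauss). exp (- U (fst z)) / Z * f z)"
    and "integrable (target U) f \<longleftrightarrow> integrable (lborel \<Otimes>\<^sub>M std_gauss) (\<lambda>z. exp (- U (fst z)) / Z * f z)"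
  unfolding target_eq using Z_pos by (simp_all add: integral_density integrable_density)

lemma measurable_generator_parts:
  assumes phi: "\<phi> \<in> Cc_infty"
  shows "transport \<phi> \<in> borel_measurable (borel \<Otimes>\<^sub>M borel)"
    and "jump U (q0 U \<epsilon>) \<phi> \<in> borel_measurable (borel \<Otimes>\<^sub>M borel)"
    and "(\<lambda>z. \<phi> z * (grad U (fst z) \<bullet> snd z)) \<in> borel_measurable (borel \<Otimes>\<^sub>M borel)"
proof -
  have "grad \<phi> \<in> borel_measurable borel"
    by (rule borel_measurable_continuous_onI[OF Cc_infty_continuous_grad[OF phi]])
  moreover have "fst \<in> borel_measurable (borel :: ((real ^ 'n) \<times> (real ^ 'n)) measure)"
    by (intro borel_measurable_continuous_onI continuous_intros)
  ultimately have [measurable]: "(\<lambda>z. fst (grad \<phi> z)) \<in> borel_measurable (borel \<Otimes>\<^sub>M borel)"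
    unfolding borel_prod by (rule measurable_compose)
  show "transport \<phi> \<in> borel_measurable (borel \<Otimes>\<^sub>M borel)"
    unfolding transport_eq(1)[OF phi, abs_def] by measurable
  show "jump U (q0 U \<epsilon>) \<phi> \<in> borel_measurable (borel \<Otimes>\<^sub>M borel)"
    by (intro measurable_jump_q0 Cc_infty_borel_measurable phi grad_measurable eps)
  have [measurable]: "\<phi> \<in> borel_measurable (borel \<Otimes>\<^sub>M borel)"
    using Cc_infty_borel_measurable[OF phi] by (simp only: borel_prod)
  show "(\<lambda>z. \<phi> z * (grad U (fst z) \<bullet> snd z)) \<in> borel_measurable (borel \<Otimes>\<^sub>M borel)"
    by measurable
qed

text \<open>All three functions vanish for \<open>x\<close> outside a ball, on which the gradient of \<open>U\<close> is bounded; as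
  functions of \<open>v\<close> they grow at most quadratically.\<close>

lemma integrable_generator_parts:
  assumes phi: "\<phi> \<in> Cc_infty"
  shows "integrable (target U) (transport \<phi>)"
    and "integrable (target U) (jump U (q0 U \<epsilon>) \<phi>)"
    and "integrable (target U) (\<lambda>z. \<phi> z * (grad U (fst z) \<bullet> snd z))"
proof -
  obtain R where R: "0 \<le> R" "\<And>z. R < norm z \<Longrightarrow> \<phi> z = 0"
    by (rule Cc_infty_support[OF phi]) (rule that)
  obtain M where M: "0 \<le> M" "\<And>z. \<bar>\<phi> z\<bar> \<le> M"
    by (rule Cc_infty_bounded[OF phi]) (rule that)
  obtain L where L: "0 \<le> L" "\<And>z. norm (grad \<phi> z) \<le> L"
    by (rule Cc_infty_grad_bounded[OF phi]) (rule that)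
  have supp: "\<phi> (x, v) = 0" if "R < norm x" for x v
    using that norm_fst_le[of x v] by (intro R(2)) simp
  have "bounded (grad U ` cball 0 R)"
    by (intro compact_imp_bounded compact_continuous_image
        continuous_on_subset[OF C_1_continuous_grad[OF U]]) auto
  then obtain G where "\<forall>y\<in>grad U ` cball 0 R. norm y \<le> G"
    unfolding bounded_iff by blast
  then have G: "norm (grad U x) \<le> G" if "norm x \<le> R" for x
    using that by simp
  have G0: "0 \<le> G" using order_trans[OF norm_ge_zero G[of 0]] R(1) by simp
  show "integrable (target U) (transport \<phi>)"
  proof (rule integrable_target_bound[OF measurable_generator_parts(1)[OF phi]])
    fix z :: "(real ^ 'n) \<times> (real ^ 'n)"
    have "\<bar>transport \<phi> z\<bar> \<le> norm (snd z) * norm (fst (grad \<phi> z))"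
      unfolding transport_eq(1)[OF phi] by (rule Cauchy_Schwarz_ineq2)
    also have "\<dots> \<le> (1 + (norm (snd z))\<^sup>2) * L"
      using order_trans[OF norm_fst_le[of "fst (grad \<phi> z)" "snd (grad \<phi> z)"], of L] L(2)[of z]
      by (intro mult_mono norm_le_1_plus_square) auto
    finally show "\<bar>transport \<phi> z\<bar> \<le> L * (1 + (norm (snd z))\<^sup>2)" by (simp only: mult.commute)
  qed
  show "integrable (target U) (jump U (q0 U \<epsilon>) \<phi>)"
  proof (rule integrable_target_bound[OF measurable_generator_parts(2)[OF phi]])
    fix z :: "(real ^ 'n) \<times> (real ^ 'n)"
    obtain x v where z: "z = (x, v)" by force
    show "\<bar>jump U (q0 U \<epsilon>) \<phi> z\<bar> \<le> (2 * L * G) * (1 + (norm (snd z))\<^sup>2)"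
    proof (cases "norm x \<le> R")
      case True
      have "\<bar>\<phi> (x, v) - \<phi> (x, w)\<bar> \<le> L * norm (v - w)" for v w
        using Cc_infty_lipschitz[OF phi L(2), of "(x, v)" "(x, w)"] by (simp add: norm_Pair)
      then have "\<bar>jump U (q0 U \<epsilon>) \<phi> (x, v)\<bar> \<le> 2 * L * norm (grad U x) * (1 + (norm v)\<^sup>2)"
        by (rule jump_q0_bound[OF Cc_infty_borel_measurable[OF phi] pos _ L(1)])
      also have "\<dots> \<le> 2 * L * G * (1 + (norm v)\<^sup>2)"
        using G[OF True] L(1) by (intro mult_right_mono mult_left_mono) auto
      finally show ?thesis by (simp add: z)
    next
      case False
      then have "jump U (q0 U \<epsilon>) \<phi> z = 0"
        by (simp add: z jump_def supp)
      then show ?thesis using L(1) G0 by simp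
    qed
  qed
  show "integrable (target U) (\<lambda>z. \<phi> z * (grad U (fst z) \<bullet> snd z))"
  proof (rule integrable_target_bound[OF measurable_generator_parts(3)[OF phi]])
    fix z :: "(real ^ 'n) \<times> (real ^ 'n)"
    obtain x v where z: "z = (x, v)" by force
    show "\<bar>\<phi> z * (grad U (fst z) \<bullet> snd z)\<bar> \<le> (M * G) * (1 + (norm (snd z))\<^sup>2)"
    proof (cases "norm x \<le> R")
      case True
      have "\<bar>grad U x \<bullet> v\<bar> \<le> norm (grad U x) * norm v" by (rule Cauchy_Schwarz_ineq2)
      also have "\<dots> \<le> G * (1 + (norm v)\<^sup>2)"
        using G[OF True] G0 by (intro mult_mono norm_le_1_plus_square) auto
      finally have "\<bar>\<phi> (x, v)\<bar> * \<bar>grad U x \<bullet> v\<bar> \<le> M * (G * (1 + (norm v)\<^sup>2))"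
        using M by (intro mult_mono) auto
      then show ?thesis by (simp add: z abs_mult)
    next
      case False
      then show ?thesis using M(1) G0 by (simp add: z supp)
    qed
  qed
qed

lemma jump_integral:
  assumes phi: "\<phi> \<in> Cc_infty"
  shows "(LINT z|target U. jump U (q0 U \<epsilon>) \<phi> z) = - (LINT z|target U. \<phi> z * (grad U (fst z) \<bullet> snd z))"
proof -
  obtain M where M: "\<And>z. \<bar>\<phi> z\<bar> \<le> M"
    using Cc_infty_bounded[OF phi] by metis
  have phi_meas: "\<phi> \<in> borel_measurable borel" by (rule Cc_infty_borel_measurable[OF phi])
  then have phi2[measurable]: "\<phi> \<in> borel_measurable (borel \<Otimes>\<^sub>M borel)"
    by (simp only: borel_prod)
  have inner: "(LINT v|std_gauss. jump U (q0 U \<epsilon>) \<phi> (x, v)) = - (LINT v|std_gauss. \<phi> (x, v) * (grad U x \<bullet> v))" for x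
  proof -
    have "(\<lambda>v. \<phi> (x, v)) \<in> borel_measurable borel" by measurable
    then show ?thesis
      unfolding jump_q0[OF phi_meas]
      by (rule gauss_jump_integral[OF pos unit_grad_norm grad_along_unit_grad _ M])
  qed
  have "(LINT z|target U. jump U (q0 U \<epsilon>) \<phi> z) =
      (LINT x|lborel. LINT v|std_gauss. exp (- U x) / Z * jump U (q0 U \<epsilon>) \<phi> (x, v))"
    unfolding integral_target(1)[OF measurable_generator_parts(2)[OF phi]]
    using phase.integral_fst'[OF integrable_generator_parts(2)[OF phi, unfolded integral_target(2)[OF measurable_generator_parts(2)[OF phi]]], symmetric]
    by simp
  also have "\<dots> = - (LINT x|lborel. LINT v|std_gauss. exp (- U x) / Z * (\<phi> (x, v) * (grad U x \<bullet> v)))"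
    unfolding integral_mult_right_zero inner by simp
  also have "(LINT x|lborel. LINT v|std_gauss. exp (- U x) / Z * (\<phi> (x, v) * (grad U x \<bullet> v))) =
      (LINT z|target U. \<phi> z * (grad U (fst z) \<bullet> snd z))"
    unfolding integral_target(1)[OF measurable_generator_parts(3)[OF phi]]
    using phase.integral_fst'[OF integrable_generator_parts(3)[OF phi, unfolded integral_target(2)[OF measurable_generator_parts(3)[OF phi]]]]
    by simp
  finally show ?thesis .
qed

lemma transport_integral:
  assumes phi: "\<phi> \<in> Cc_infty"
  shows "(LINT z|target U. transport \<phi> z) = (LINT z|target U. \<phi> z * (grad U (fst z) \<bullet> snd z))"
proof -
  have swap: "(LINT z|target U. f z) = (LINT v|std_gauss. (LINT x|lborel. exp (- U x) * f (x, v)) / Z)"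
    if m: "f \<in> borel_measurable (borel \<Otimes>\<^sub>M borel)" and i: "integrable (target U) f" for f
  proof -
    have "integrable (lborel \<Otimes>\<^sub>M std_gauss) (\<lambda>(x, v). exp (- U x) / Z * f (x, v))"
      using i[unfolded integral_target(2)[OF m]] by (simp add: case_prod_unfold)
    from phase.integral_snd[OF this, symmetric] show ?thesis
      unfolding integral_target(1)[OF m] by (simp add: case_prod_unfold)
  qed
  show ?thesis
    unfolding swap[OF measurable_generator_parts(1)[OF phi] integrable_generator_parts(1)[OF phi]]
      swap[OF measurable_generator_parts(3)[OF phi] integrable_generator_parts(3)[OF phi]]
    by (simp add: transport_integral_by_parts[OF U phi])
qed

lemma gen_L_integral:
  assumes phi: "\<phi> \<in> Cc_infty"
  shows "integrable (target U) (gen_L U (q0 U \<epsilon>) \<phi>)"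
    and "(LINT z|target U. gen_L U (q0 U \<epsilon>) \<phi> z) = 0"
  unfolding gen_L_def[abs_def]
  using integrable_generator_parts[OF phi] by (simp_all add: jump_integral[OF phi] transport_integral[OF phi])

end

section \<open>From a core to an invariant measure\<close>

text \<open>Only the right derivative is available for semigroup orbits. Given a slope \<open>e > 0\<close>, look at the last
  time up to \<open>T\<close> at which \<open>\<bar>u t - u 0\<bar> \<le> e * t\<close>; were it before \<open>T\<close>, the right derivative there would
  carry the inequality a little further.\<close>

lemma right_derivative_0_imp_constant:
  fixes u :: "real \<Rightarrow> real"
  assumes "0 \<le> T" and cont: "continuous_on {0..T} u"
    and der: "\<And>t. 0 \<le> t \<Longrightarrow> t < T \<Longrightarrow> ((\<lambda>h. (u (t + h) - u t) / h) \<longlongrightarrow> 0) (at_right 0)"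
  shows "u T = u 0"
proof -
  have "\<bar>u T - u 0\<bar> \<le> e * T" if "e > 0" for e
  proof (rule ccontr)
    define g where "g t = \<bar>u t - u 0\<bar> - e * t" for t
    assume "\<not> ?thesis"
    then have gT: "g T > 0" by (simp add: g_def)
    \<comment> \<open>This set of times is compact, so it contains a last one.\<close>
    let ?S = "{t \<in> {0..T}. g t \<le> 0}"
    have "continuous_on {0..T} g"
      unfolding g_def by (intro continuous_intros cont)
    then have "closed ?S"
      by (intro continuous_on_closed_Collect_le continuous_intros) auto
    moreover have "bounded ?S"
      by (rule bounded_subset[of "{0..T}"]) auto
    ultimately have "compact ?S" by (simp add: compact_eq_bounded_closed)
    moreover have "0 \<in> ?S" using \<open>0 \<le> T\<close> by (simp add: g_def)
    ultimately obtain s where s: "s \<in> ?S" "\<And>t. t \<in> ?S \<Longrightarrow> t \<le> s"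
      using compact_attains_sup[of ?S] by blast
    have "s < T" using s(1) gT by (cases "s = T") auto
    have "eventually (\<lambda>h. \<bar>(u (s + h) - u s) / h\<bar> < e) (at_right 0)"
      using der[of s] s(1) \<open>s < T\<close> \<open>e > 0\<close> by (auto simp: tendsto_iff dist_real_def)
    moreover have "eventually (\<lambda>h. h \<in> {0<..<T - s}) (at_right 0)"
      using \<open>s < T\<close> by (intro eventually_at_right_real) auto
    ultimately have "eventually (\<lambda>h. \<bar>(u (s + h) - u s) / h\<bar> < e \<and> h \<in> {0<..<T - s}) (at_right 0)"
      by (rule eventually_conj)
    then obtain h where h: "\<bar>(u (s + h) - u s) / h\<bar> < e" "0 < h" "h < T - s"
      using eventually_happens trivial_limit_at_right_real by fastforce
    then have "\<bar>u (s + h) - u s\<bar> < e * h"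
      by (simp add: field_simps)
    then have "g (s + h) \<le> g s"
      by (simp add: g_def algebra_simps)
    then have "s + h \<in> ?S"
      using s(1) h by auto
    then show False using s(2) h(2) by fastforce
  qed note bound = this
  have "\<bar>u T - u 0\<bar> \<le> 0"
  proof (rule field_le_epsilon)
    fix e :: real assume "e > 0"
    then have "e / (T + 1) * T \<le> e"
      using \<open>0 \<le> T\<close> by (simp add: field_simps)
    then show "\<bar>u T - u 0\<bar> \<le> 0 + e"
      using bound[of "e / (T + 1)"] \<open>e > 0\<close> \<open>0 \<le> T\<close> by simp
  qed
  then show ?thesis by simp
qed

lemma function_space_scale:
  "function_space \<mu> E N \<Longrightarrow> f \<in> E \<Longrightarrow> (\<lambda>z. c * f z) \<in> E \<and> N (\<lambda>z. c * f z) = \<bar>c\<bar> * N f"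
  unfolding function_space_def by blast

lemma function_space_add:
  "function_space \<mu> E N \<Longrightarrow> f \<in> E \<Longrightarrow> g \<in> E \<Longrightarrow>
    (\<lambda>z. f z + g z) \<in> E \<and> N (\<lambda>z. f z + g z) \<le> N f + N g"
  unfolding function_space_def by blast

lemma function_space_diff:
  assumes "function_space \<mu> E N" "f \<in> E" "g \<in> E"
  shows "(\<lambda>z. f z - g z) \<in> E" "N (\<lambda>z. f z - g z) \<le> N f + N g"
  using function_space_add[OF assms(1,2), of "\<lambda>z. -1 * g z"]
    function_space_scale[OF assms(1,3), of "-1"] by simp_all

lemma function_space_triangle:
  assumes "function_space \<mu> E N" "f \<in> E" "g \<in> E" "h \<in> E"
  shows "N (\<lambda>z. f z - h z) \<le> N (\<lambda>z. f z - g z) + N (\<lambda>z. g z - h z)"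
  using function_space_add[OF assms(1) function_space_diff(1)[OF assms(1,2,3)]
      function_space_diff(1)[OF assms(1,3,4)]] by simp

lemma function_space_commute:
  assumes "function_space \<mu> E N" "f \<in> E" "g \<in> E"
  shows "N (\<lambda>z. f z - g z) = N (\<lambda>z. g z - f z)"
  using function_space_scale[OF assms(1) function_space_diff(1)[OF assms], of "-1"] by simp

lemma function_space_nonneg:
  assumes "function_space \<mu> E N" "f \<in> E"
  shows "0 \<le> N f"
  using function_space_scale[OF assms, of 0] function_space_diff(2)[OF assms assms(2)] by simp

lemma function_space_integrable: "function_space \<mu> E N \<Longrightarrow> f \<in> E \<Longrightarrow> integrable \<mu> f"
  unfolding function_space_def by blast

text \<open>Integration is a bounded functional on the function space; this is how convergence in the seminorm
  passes to integrals.\<close>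

lemma function_space_integral_bound:
  assumes "function_space \<mu> E N"
  obtains C where "0 \<le> C" "\<And>f. f \<in> E \<Longrightarrow> \<bar>LINT z|\<mu>. f z\<bar> \<le> C * N f"
proof -
  obtain C where C: "\<And>f. f \<in> E \<Longrightarrow> (LINT z|\<mu>. \<bar>f z\<bar>) \<le> C * N f"
    using assms unfolding function_space_def by blast
  have "\<bar>LINT z|\<mu>. f z\<bar> \<le> max C 0 * N f" if "f \<in> E" for f
  proof -
    have "\<bar>LINT z|\<mu>. f z\<bar> \<le> (LINT z|\<mu>. \<bar>f z\<bar>)" by (rule integral_abs_bound)
    also have "\<dots> \<le> C * N f" by (rule C[OF that])
    also have "\<dots> \<le> max C 0 * N f"
      using function_space_nonneg[OF assms that] by (intro mult_right_mono) auto
    finally show ?thesis .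
  qed
  then show ?thesis using that[of "max C 0"] by simp
qed

text \<open>A generator is single-valued up to functions of seminorm zero, so on the core the second component of
  the graph has the same integral as \<open>L \<phi>\<close>, namely zero. The integral is continuous for the seminorm and
  the core is dense in the graph.\<close>

lemma integral_generator_eq_0:
  assumes fs: "function_space \<mu> E N" and core: "is_core N (generator E N S) D"
    and E: "\<And>h f. 0 \<le> h \<Longrightarrow> f \<in> E \<Longrightarrow> S h f \<in> E"
    and L: "\<And>\<phi>. \<phi> \<in> D \<Longrightarrow> (\<phi>, L \<phi>) \<in> generator E N S" "\<And>\<phi>. \<phi> \<in> D \<Longrightarrow> (LINT z|\<mu>. L \<phi> z) = 0"
    and fg: "(f, g) \<in> generator E N S"
  shows "(LINT z|\<mu>. g z) = 0"
proof -
  obtain C where C: "0 \<le> C" "\<And>f. f \<in> E \<Longrightarrow> \<bar>LINT z|\<mu>. f z\<bar> \<le> C * N f"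
    using function_space_integral_bound[OF fs] by blast
  have gE: "g \<in> E" using fg by (simp add: generator_def)
  have null: "N (\<lambda>z. \<psi> z - L \<phi> z) = 0" if "\<phi> \<in> D" "(\<phi>, \<psi>) \<in> generator E N S" for \<phi> \<psi>
  proof -
    have mem: "\<phi> \<in> E" "\<psi> \<in> E" "L \<phi> \<in> E"
      using that L(1)[OF that(1)] by (auto simp: generator_def)
    let ?Q = "\<lambda>h z. (S h \<phi> z - \<phi> z) / h"
    have "((\<lambda>h. N (\<lambda>z. ?Q h z - \<psi> z) + N (\<lambda>z. ?Q h z - L \<phi> z)) \<longlongrightarrow> 0 + 0) (at_right 0)"
      using that L(1)[OF that(1)] by (intro tendsto_add) (auto simp: generator_def)
    moreover have "eventually (\<lambda>h. N (\<lambda>z. \<psi> z - L \<phi> z) \<le>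
        N (\<lambda>z. ?Q h z - \<psi> z) + N (\<lambda>z. ?Q h z - L \<phi> z)) (at_right 0)"
      using eventually_at_right_less[of "0::real"]
    proof eventually_elim
      case (elim h)
      have "?Q h \<in> E"
        using function_space_scale[OF fs function_space_diff(1)[OF fs E[of h \<phi>] mem(1)], of "1/h"] elim mem
        by simp
      then show ?case
        using function_space_triangle[OF fs mem(2) _ mem(3), of "?Q h"]
          function_space_commute[OF fs _ mem(2), of "?Q h"] by simp
    qed
    ultimately have "N (\<lambda>z. \<psi> z - L \<phi> z) \<le> 0 + 0"
      by (intro tendsto_lowerbound) auto
    then show ?thesis
      using function_space_nonneg[OF fs function_space_diff(1)[OF fs mem(2,3)]] by simp
  qed
  have "\<bar>LINT z|\<mu>. g z\<bar> \<le> C * \<delta>" if "\<delta> > 0" for \<delta>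
  proof -
    have "\<exists>p\<in>generator E N S. case p of (\<phi>, \<psi>) \<Rightarrow>
        \<phi> \<in> D \<and> N (\<lambda>z. f z - \<phi> z) < \<delta> \<and> N (\<lambda>z. g z - \<psi> z) < \<delta>"
      using bspec[OF conjunct2[OF core[unfolded is_core_def]] fg] that by simp
    then obtain p where p: "p \<in> generator E N S"
      "case p of (\<phi>, \<psi>) \<Rightarrow> \<phi> \<in> D \<and> N (\<lambda>z. f z - \<phi> z) < \<delta> \<and> N (\<lambda>z. g z - \<psi> z) < \<delta>" ..
    then obtain \<phi> \<psi> where ps: "(\<phi>, \<psi>) \<in> generator E N S" "\<phi> \<in> D" "N (\<lambda>z. g z - \<psi> z) < \<delta>"
      by (cases p) simp
    have mem: "\<psi> \<in> E" "L \<phi> \<in> E"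
      using ps L(1)[OF ps(2)] by (auto simp: generator_def)
    have "N (\<lambda>z. g z - L \<phi> z) \<le> \<delta>"
      using function_space_triangle[OF fs gE mem] null[OF ps(2,1)] ps(3) by simp
    then have "C * N (\<lambda>z. g z - L \<phi> z) \<le> C * \<delta>"
      using C(1) by (intro mult_left_mono) auto
    moreover have "(LINT z|\<mu>. g z - L \<phi> z) = (LINT z|\<mu>. g z)"
      using L(2)[OF ps(2)] function_space_integrable[OF fs] gE mem
      by (subst Bochner_Integration.integral_diff) auto
    ultimately show ?thesis
      using C(2)[OF function_space_diff(1)[OF fs gE mem(2)]] by simp
  qed note bound = this
  have "\<bar>LINT z|\<mu>. g z\<bar> \<le> 0"
  proof (rule field_le_epsilon)
    fix e :: real assume "e > 0"
    then have "C * (e / (C + 1)) \<le> e" using C(1) by (simp add: field_simps)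
    then show "\<bar>LINT z|\<mu>. g z\<bar> \<le> 0 + e"
      using bound[of "e / (C + 1)"] \<open>e > 0\<close> C(1) by simp
  qed
  then show ?thesis by simp
qed

lemma C0_semigroup_mem: "C0_semigroup E N S \<Longrightarrow> 0 \<le> t \<Longrightarrow> f \<in> E \<Longrightarrow> S t f \<in> E"
  unfolding C0_semigroup_def by blast

text \<open>Linearity, the initial value and the semigroup law hold only up to functions of seminorm zero, while
  the orbits are continuous in the seminorm.\<close>

lemmas C0_semigroup_linear =
  C0_semigroup_def[THEN iffD1, THEN conjunct2, THEN conjunct1, rule_format]

lemmas C0_semigroup_zero =
  C0_semigroup_def[THEN iffD1, THEN conjunct2, THEN conjunct2, THEN conjunct1, rule_format]

lemmas C0_semigroup_add =
  C0_semigroup_def[THEN iffD1, THEN conjunct2, THEN conjunct2, THEN conjunct2, THEN conjunct1, rule_format]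

lemmas C0_semigroup_continuous =
  C0_semigroup_def[THEN iffD1, THEN conjunct2, THEN conjunct2, THEN conjunct2, THEN conjunct2, rule_format]

text \<open>The difference quotient of \<open>S t f\<close> is \<open>S t\<close> applied to that of \<open>f\<close>, and \<open>S t\<close> is bounded. Since
  linearity and the semigroup law hold only up to seminorm zero, the comparison passes through a chain of
  functions at distance zero from each other.\<close>

lemma generator_semigroup_invariant:
  assumes fs: "function_space \<mu> E N" and sg: "C0_semigroup E N S"
    and fg: "(f, g) \<in> generator E N S" and "0 \<le> t"
  shows "(S t f, S t g) \<in> generator E N S"
proof -
  have mem: "f \<in> E" "g \<in> E" using fg by (auto simp: generator_def)
  note SE = C0_semigroup_mem[OF sg] and lin = C0_semigroup_linear[OF sg \<open>0 \<le> t\<close>]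
    and add = C0_semigroup_add[OF sg]
  obtain C where C: "\<And>h. h \<in> E \<Longrightarrow> N (S t h) \<le> C * N h"
    using sg[unfolded C0_semigroup_def, THEN conjunct1, rule_format, OF \<open>0 \<le> t\<close>] by blast
  note diff = function_space_diff(1)[OF fs] and tri = function_space_triangle[OF fs]
    and com = function_space_commute[OF fs] and nonneg = function_space_nonneg[OF fs]
  have scale: "(\<lambda>z. c * h z) \<in> E" if "h \<in> E" for c h
    using function_space_scale[OF fs that] by blast
  let ?Q = "\<lambda>h z. (S h f z - f z) / h"
  \<comment> \<open>The functions \<open>w\<close>, \<open>r\<close>, \<open>q\<close>, \<open>p\<close> below are at distance zero: \<open>w\<close> and \<open>r\<close> differ by commuting \<open>S h\<close> with \<open>S t\<close>, the others by linearity of \<open>S t\<close>.\<close>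
  have main: "N (\<lambda>z. (S h (S t f) z - S t f z) / h - S t g z) \<le> C * N (\<lambda>z. ?Q h z - g z)"
    if "h > 0" for h
  proof -
    have Sf: "S h f \<in> E" using SE that mem by simp
    have QE: "?Q h \<in> E" using scale[OF diff[OF Sf mem(1)], of "1/h"] by simp
    define p where "p = S t (\<lambda>z. ?Q h z - g z)"
    define q where "q = (\<lambda>z. S t (?Q h) z - S t g z)"
    define r where "r = (\<lambda>z. (1/h) * (S t (S h f) z - S t f z) - S t g z)"
    define w where "w = (\<lambda>z. (1/h) * (S h (S t f) z - S t f z) - S t g z)"
    have E: "p \<in> E" "q \<in> E" "r \<in> E" "w \<in> E"
      unfolding p_def q_def r_def w_def
      by (intro diff scale SE mem QE Sf \<open>0 \<le> t\<close> less_imp_le[OF that])+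
    have pq: "N (\<lambda>z. q z - p z) = 0"
      using lin[OF QE mem(2), of 1 "-1"] com[OF E(1,2)] by (simp add: p_def q_def)
    have "N (\<lambda>z. S t (?Q h) z - (1/h * S t (S h f) z + (-1/h) * S t f z)) = 0"
      using lin[OF Sf mem(1), of "1/h" "-1/h"] by (simp add: diff_divide_distrib)
    then have qr: "N (\<lambda>z. r z - q z) = 0"
      using com[OF E(2,3)] by (simp add: q_def r_def diff_divide_distrib algebra_simps)
    have a1: "N (\<lambda>z. S h (S t f) z - S (h + t) f z) = 0"
      using add[of h t f] com[OF SE[of "h + t" f] SE[OF less_imp_le[OF that] SE[of t f]]]
        mem \<open>0 \<le> t\<close> that by simp
    have a2: "N (\<lambda>z. S (h + t) f z - S t (S h f) z) = 0"
      using add[of t h f] mem \<open>0 \<le> t\<close> that by (simp add: add.commute)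
    have E2: "S h (S t f) \<in> E" "S (h + t) f \<in> E" "S t (S h f) \<in> E"
      using SE mem \<open>0 \<le> t\<close> that by auto
    have "N (\<lambda>z. S h (S t f) z - S t (S h f) z) = 0"
      using tri[OF E2] a1 a2 nonneg[OF diff[OF E2(1,3)]] by simp
    then have wr: "N (\<lambda>z. w z - r z) = 0"
      using function_space_scale[OF fs diff[OF E2(1,3)], of "1/h"]
      by (simp add: w_def r_def diff_divide_distrib)
    have "N w \<le> N (\<lambda>z. w z - p z) + N p"
      using function_space_add[OF fs diff[OF E(4,1)] E(1)] by simp
    also have "N (\<lambda>z. w z - p z) \<le> 0"
      using tri[OF E(4,3,1)] tri[OF E(3,2,1)] wr qr pq by simp
    finally have "N w \<le> N p" by simp
    also have "N p \<le> C * N (\<lambda>z. ?Q h z - g z)"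
      unfolding p_def by (intro C diff QE mem)
    finally show ?thesis by (simp add: w_def)
  qed
  have "((\<lambda>h. N (\<lambda>z. (S h (S t f) z - S t f z) / h - S t g z)) \<longlongrightarrow> 0) (at_right 0)"
  proof (rule tendsto_sandwich)
    show "eventually (\<lambda>h. N (\<lambda>z. (S h (S t f) z - S t f z) / h - S t g z) \<le> C * N (\<lambda>z. ?Q h z - g z)) (at_right 0)"
      using eventually_at_right_less[of "0::real"] by eventually_elim (rule main)
    show "eventually (\<lambda>h. 0 \<le> N (\<lambda>z. (S h (S t f) z - S t f z) / h - S t g z)) (at_right 0)"
      using eventually_at_right_less[of "0::real"]
    proof eventually_elim
      case (elim h)
      have "(\<lambda>z. 1/h * (S h (S t f) z - S t f z) - S t g z) \<in> E"
        using elim \<open>0 \<le> t\<close> by (intro diff scale SE mem) auto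
      then show ?case using nonneg by simp
    qed
    have "((\<lambda>h. N (\<lambda>z. ?Q h z - g z)) \<longlongrightarrow> 0) (at_right 0)"
      using fg by (simp add: generator_def)
    then show "((\<lambda>h. C * N (\<lambda>z. ?Q h z - g z)) \<longlongrightarrow> 0) (at_right 0)"
      using tendsto_mult_right_zero by blast
  qed simp
  then show ?thesis
    using SE mem \<open>0 \<le> t\<close> by (simp add: generator_def)
qed

text \<open>The right derivative of \<open>t \<mapsto> \<integral>S t f d\<mu>\<close> is the integral of the second component of a graph element,
  \<open>S t g\<close>, and so vanishes. The left derivative would need bounds on \<open>S t\<close> that are uniform in \<open>t\<close>, and
  these can fail on an incomplete space.\<close>

lemma semigroup_preserves_integral:
  assumes fs: "function_space \<mu> E N" and sg: "C0_semigroup E N S"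
    and zero: "\<And>f g. (f, g) \<in> generator E N S \<Longrightarrow> (LINT z|\<mu>. g z) = 0"
    and fg: "(f, g) \<in> generator E N S" and "0 \<le> T"
  shows "(LINT z|\<mu>. S T f z) = (LINT z|\<mu>. f z)"
proof -
  obtain C where C: "0 \<le> C" "\<And>f. f \<in> E \<Longrightarrow> \<bar>LINT z|\<mu>. f z\<bar> \<le> C * N f"
    using function_space_integral_bound[OF fs] by blast
  have mem: "f \<in> E" "g \<in> E" using fg by (auto simp: generator_def)
  note SE = C0_semigroup_mem[OF sg]
  note diff = function_space_diff(1)[OF fs] and int = function_space_integrable[OF fs]
  define u where "u t = (LINT z|\<mu>. S t f z)" for t
  have u_diff: "u s - u t = (LINT z|\<mu>. S s f z - S t f z)" if "0 \<le> s" "0 \<le> t" for s t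
    using that by (simp add: u_def int SE mem)
  have cont: "continuous_on {0..} u"
    unfolding continuous_on_def
  proof
    fix t :: real assume "t \<in> {0..}"
    then have t: "0 \<le> t" by simp
    have "((\<lambda>s. N (\<lambda>z. S s f z - S t f z)) \<longlongrightarrow> 0) (at t within {0..})"
      by (rule C0_semigroup_continuous[OF sg mem(1) t])
    then have lim: "((\<lambda>s. C * N (\<lambda>z. S s f z - S t f z)) \<longlongrightarrow> 0) (at t within {0..})"
      using tendsto_mult_right_zero by blast
    have "((\<lambda>s. u s - u t) \<longlongrightarrow> 0) (at t within {0..})"
    proof (rule Lim_null_comparison[OF _ lim])
      show "eventually (\<lambda>s. norm (u s - u t) \<le> C * N (\<lambda>z. S s f z - S t f z)) (at t within {0..})"
        unfolding eventually_at_filter using t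
        by (auto simp: u_diff intro!: always_eventually C(2) diff SE mem)
    qed
    then show "(u \<longlongrightarrow> u t) (at t within {0..})" by (simp add: LIM_zero_iff)
  qed
  have der: "((\<lambda>h. (u (t + h) - u t) / h) \<longlongrightarrow> 0) (at_right 0)" if t: "0 \<le> t" for t
  proof -
    have gen: "(S t f, S t g) \<in> generator E N S"
      by (rule generator_semigroup_invariant[OF fs sg fg t])
    let ?Q = "\<lambda>h z. (S h (S t f) z - S t f z) / h - S t g z"
    have "((\<lambda>h. N (?Q h)) \<longlongrightarrow> 0) (at_right 0)"
      using gen by (simp add: generator_def)
    then have lim: "((\<lambda>h. C * N (?Q h)) \<longlongrightarrow> 0) (at_right 0)"
      using tendsto_mult_right_zero by blast
    show ?thesis
    proof (rule Lim_null_comparison[OF _ lim])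
      show "eventually (\<lambda>h. norm ((u (t + h) - u t) / h) \<le> C * N (?Q h)) (at_right 0)"
        using eventually_at_right_less[of "0::real"]
      proof eventually_elim
        case (elim h)
        have E: "S (h + t) f \<in> E" "S h (S t f) \<in> E" "S t f \<in> E" "S t g \<in> E"
          using elim t by (auto intro!: SE mem)
        have "N (\<lambda>z. S (h + t) f z - S h (S t f) z) = 0"
          using elim t by (intro C0_semigroup_add[OF sg] mem) auto
        then have "(LINT z|\<mu>. S (h + t) f z - S h (S t f) z) = 0"
          using C(2)[OF diff[OF E(1,2)]] by simp
        then have "u (t + h) = (LINT z|\<mu>. S h (S t f) z)"
          using E by (simp add: u_def int add.commute)
        then have "(LINT z|\<mu>. ?Q h z) = (u (t + h) - u t) / h"
          using E zero[OF gen] by (simp add: u_def int)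
        moreover have "(\<lambda>z. 1 / h * (S h (S t f) z - S t f z)) \<in> E"
          using function_space_scale[OF fs diff[OF E(2,3)]] by blast
        then have "?Q h \<in> E"
          using diff[OF _ E(4)] by simp
        ultimately show ?case
          using C(2) by fastforce
      qed
    qed
  qed
  have "u T = u 0"
    using \<open>0 \<le> T\<close> der continuous_on_subset[OF cont, of "{0..T}"]
    by (intro right_derivative_0_imp_constant) auto
  moreover have "N (\<lambda>z. S 0 f z - f z) = 0"
    by (rule C0_semigroup_zero[OF sg mem(1)])
  then have "(LINT z|\<mu>. S 0 f z - f z) = 0"
    using C(2)[OF diff[OF SE[of 0 f] mem(1)]] mem by simp
  then have "u 0 = (LINT z|\<mu>. f z)"
    using SE[of 0 f] mem int by (simp add: u_def)
  ultimately show ?thesis by (simp add: u_def)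
qed

text \<open>Apply the preservation of integrals to non-negative test functions, for which the integral against
  \<open>\<mu> \<bind> P t\<close> is the iterated integral.\<close>

lemma invariant_measure_of_core:
  fixes P :: "real \<Rightarrow> 'z::euclidean_space \<Rightarrow> 'z measure"
  assumes mu: "prob_space \<mu>" "sets \<mu> = sets borel"
    and zero: "\<And>\<phi>. \<phi> \<in> Cc_infty \<Longrightarrow> (LINT z|\<mu>. L \<phi> z) = 0"
    and gen: "markov_with_generator \<mu> E N P L Cc_infty"
    and core: "is_core N (generator E N (transition_op P)) Cc_infty"
  shows "invariant_measure P \<mu>"
  unfolding invariant_measure_def
proof (intro allI impI)
  fix t :: real assume t: "0 \<le> t"
  have fs: "function_space \<mu> E N" and sg: "C0_semigroup E N (transition_op P)"
    and L: "\<And>\<phi>. \<phi> \<in> Cc_infty \<Longrightarrow> (\<phi>, L \<phi>) \<in> generator E N (transition_op P)"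
    and P: "P t \<in> borel \<rightarrow>\<^sub>M prob_algebra borel"
    using gen t by (auto simp: markov_with_generator_def markov_transition_def)
  have P': "P t \<in> \<mu> \<rightarrow>\<^sub>M prob_algebra borel"
    using P mu(2) by (simp cong: measurable_cong_sets)
  then have Ps: "P t \<in> \<mu> \<rightarrow>\<^sub>M subprob_algebra borel"
    by (rule measurable_prob_algebraD)
  have Pz: "prob_space (P t z)" "sets (P t z) = sets borel" for z
    using measurable_space[OF P, of z] by (auto simp: space_prob_algebra)
  have space: "space \<mu> \<noteq> {}"
    using mu(1) by (rule prob_space.not_empty)
  have sets_bind: "sets (\<mu> \<bind> P t) = sets borel"
    using Ps space by (rule sets_bind_measurable)
  have "\<mu> = \<mu> \<bind> P t"
  proof (rule finite_measure_eqI_Cc_infty)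
    show "sets \<mu> = sets borel" "sets (\<mu> \<bind> P t) = sets borel" by fact+
    show "finite_measure \<mu>" using mu(1) by (rule prob_space.finite_measure)
    fix \<phi> :: "'z \<Rightarrow> real" assume phi: "\<phi> \<in> Cc_infty" and nn: "\<And>z. 0 \<le> \<phi> z"
    have meas: "\<phi> \<in> borel_measurable borel" by (rule Cc_infty_borel_measurable[OF phi])
    obtain M where M: "0 \<le> M" "\<And>z. \<bar>\<phi> z\<bar> \<le> M" by (rule Cc_infty_bounded[OF phi]) (rule that)
    have E: "\<phi> \<in> E" using L[OF phi] by (simp add: generator_def)
    have nonneg: "0 \<le> transition_op P t \<phi> z" for z
      unfolding transition_op_def by (rule Bochner_Integration.integral_nonneg) (rule nn)
    have point: "(\<integral>\<^sup>+w. \<phi> w \<partial>P t z) = ennreal (transition_op P t \<phi> z)" for z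
    proof -
      interpret prob_space "P t z" by (rule Pz)
      have "integrable (P t z) \<phi>"
        using meas Pz(2)[of z] M by (intro integrable_const_bound[where B = M]) (auto cong: measurable_cong_sets)
      then show ?thesis
        unfolding transition_op_def by (rule nn_integral_eq_integral) (simp add: nn)
    qed
    have "(\<integral>\<^sup>+z. \<phi> z \<partial>(\<mu> \<bind> P t)) = (\<integral>\<^sup>+z. \<integral>\<^sup>+w. \<phi> w \<partial>P t z \<partial>\<mu>)"
      using meas by (intro nn_integral_bind[OF _ Ps]) simp
    also have "\<dots> = ennreal (LINT z|\<mu>. transition_op P t \<phi> z)"
      unfolding point using C0_semigroup_mem[OF sg t E] nonneg
      by (intro nn_integral_eq_integral function_space_integrable[OF fs]) auto
    also have "(LINT z|\<mu>. transition_op P t \<phi> z) = (LINT z|\<mu>. \<phi> z)"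
    proof (rule semigroup_preserves_integral[OF fs sg _ L[OF phi] t])
      show "(LINT z|\<mu>. g z) = 0" if "(f, g) \<in> generator E N (transition_op P)" for f g
        by (rule integral_generator_eq_0[OF fs core _ L zero that]) (rule C0_semigroup_mem[OF sg])
    qed
    also have "ennreal \<dots> = (\<integral>\<^sup>+z. \<phi> z \<partial>\<mu>)"
      using function_space_integrable[OF fs E] nn by (intro nn_integral_eq_integral[symmetric]) auto
    finally show "(\<integral>\<^sup>+z. \<phi> z \<partial>\<mu>) = (\<integral>\<^sup>+z. \<phi> z \<partial>(\<mu> \<bind> P t))" ..
  qed
  then show "\<mu> \<bind> P t = \<mu>" ..
qed

section \<open>Invariance of the target\<close>

theorem lemma3p3:
  fixes U :: "real ^ 'n \<Rightarrow> real" and \<epsilon> :: "real ^ 'n \<Rightarrow> real"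
  assumes "C_k 1 U"
    and "integrable lborel (\<lambda>x. exp (- U x))"
    and "\<epsilon> \<in> borel_measurable borel"
    and "\<And>x. \<epsilon> x > 0"
  shows "(transition_kernel (q0 U \<epsilon>) \<and> average_condition U (q0 U \<epsilon>) \<and> reversible (q0 U \<epsilon>) std_gauss) \<and>
    (\<forall>\<phi>\<in>Cc_infty. integrable (target U) (gen_L U (q0 U \<epsilon>) \<phi>) \<and>
       (LINT z|target U. gen_L U (q0 U \<epsilon>) \<phi> z) = 0) \<and>
    (\<forall>P E N. markov_with_generator (target U) E N P (gen_L U (q0 U \<epsilon>)) Cc_infty \<and>
       is_core N (generator E N (transition_op P)) Cc_infty \<longrightarrow>
       invariant_measure P (target U))"
proof -
  interpret velocity_jump U \<epsilon>
    using assms by unfold_locales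
  show ?thesis
  proof (intro conjI allI ballI impI)
    show "transition_kernel (q0 U \<epsilon>)"
      by (rule transition_kernel_q0[OF grad_measurable eps])
    show "average_condition U (q0 U \<epsilon>)"
      by (rule average_condition_q0[OF pos])
    show "reversible (q0 U \<epsilon>) std_gauss"
      by (rule reversible_q0)
    show "integrable (target U) (gen_L U (q0 U \<epsilon>) \<phi>)"
      and "(LINT z|target U. gen_L U (q0 U \<epsilon>) \<phi> z) = 0" if "\<phi> \<in> Cc_infty" for \<phi>
      using that by (rule gen_L_integral)+
    show "invariant_measure P (target U)"
      if "markov_with_generator (target U) E N P (gen_L U (q0 U \<epsilon>)) Cc_infty \<and>
        is_core N (generator E N (transition_op P)) Cc_infty" for P E N
      using that by (intro invariant_measure_of_core[OF prob_space_target sets_target gen_L_integral(2)]) auto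
  qed
qed

end
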